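(* $J_{3}[76]=I_{3}[76]$.
   Context: An $S(2,4,v)$ design is a pair $(\mathcal{V},\mathcal{B})$ with $|\mathcal{V}|=v$ and $\mathcal{B}$ a family of 4-subsets (blocks) of $\mathcal{V}$ such that each 2-subset of $\mathcal{V}$ lies in exactly one block; it has $b_v=\frac{v(v-1)}{12}$ blocks. For integers $a\le b$, $[a,b]=\{a,\dots,b\}$, and $I_{3}[v]=[0,b_{v}]\setminus[b_{v}-7,b_{v}-1]$. $J_{3}[v]$ is the set of integers $k$ for which there exist three $S(2,4,v)$ designs on a common point set with block sets $\mathcal{B}_1,\mathcal{B}_2,\mathcal{B}_3$ such that $\mathcal{B}_1\cap\mathcal{B}_2=\mathcal{B}_1\cap\mathcal{B}_3=\mathcal{B}_2\cap\mathcal{B}_3$ and this common set has exactly $k$ blocks. *)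

theory Defs
  imports Main
begin

definition S24_design :: "nat \<Rightarrow> 'a set \<Rightarrow> 'a set set \<Rightarrow> bool" where
  "S24_design v V \<B> \<longleftrightarrow>
     finite V \<and> card V = v \<and>
     (\<forall>B\<in>\<B>. B \<subseteq> V \<and> card B = 4) \<and>
     (\<forall>P. P \<subseteq> V \<and> card P = 2 \<longrightarrow> (\<exists>!B. B \<in> \<B> \<and> P \<subseteq> B))"

text \<open>The division is exact whenever an \<open>S(2,4,v)\<close> design exists, and also for \<open>v = 76\<close>.\<close>

definition block_count :: "nat \<Rightarrow> int" where
  "block_count v = int v * (int v - 1) div 12"

definition I3 :: "nat \<Rightarrow> int set" where
  "I3 v = {0..block_count v} - {block_count v - 7..block_count v - 1}"

text \<open>Points are natural numbers without loss of generality: the intersection sizes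
  are invariant under renaming the points of the finite common point set. The three
  designs are not required to be distinct, so \<open>block_count v\<close> is attained as soon
  as one design exists.\<close>

definition J3 :: "nat \<Rightarrow> int set" where
  "J3 v = {k. \<exists>(V :: nat set) \<B>1 \<B>2 \<B>3.
      S24_design v V \<B>1 \<and> S24_design v V \<B>2 \<and> S24_design v V \<B>3 \<and>
      \<B>1 \<inter> \<B>2 = \<B>1 \<inter> \<B>3 \<and> \<B>1 \<inter> \<B>3 = \<B>2 \<inter> \<B>3 \<and>
      int (card (\<B>1 \<inter> \<B>2)) = k}"

end

theory Submission imports Defs begin

text \<open>
  Upper bound. Outside their common blocks, the three designs leave three pairwise disjoint
  block sets covering the same pairs. Suppose that there are between one and seven blocks in each.
  All points have degree at least 2, and each block of the first set contains a point \<open>a\<close> of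
  degree 2. The two blocks through \<open>a\<close> in another set must split the block into all but one of its
  points and the missed point \<open>d\<close>, which then has degree at least 3. The other two sets miss
  different points, so the block has exactly two points of degree 3 and two of degree 2, which
  forces seven blocks and 14 incidences with points of degree 3, although 3 does not divide 14.

  Construction. Triple every point of a linear space on 25 points and add a point at infinity.
  A line of size \<open>m\<close> becomes a complete multipartite graph of type \<open>3\<^sup>m\<close> or, together with infinity
  and for pairwise disjoint lines, a complete graph on \<open>3m + 1\<close> vertices; the intersection numbers
  of the pieces add up. An \<open>S(2,4,25)\<close> with pieces \<open>3\<^sup>4\<close> (numbers 0 and 9) and two pieces
  \<open>S(2,4,13)\<close> (numbers 0 to 5 and 13) gives 17 to 459, 462 to 467 and 475. The affine plane of
  order 5 with pieces \<open>3\<^sup>5\<close> (numbers 0, 1 and 15) gives 460 and 461, and with a parallel class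
  of pieces \<open>S(2,4,16)\<close> (number 0) it gives 0 to 25.
\<close>

section \<open>Decompositions of graphs into blocks\<close>

text \<open>Graphs are symmetric relations; taking the identity for \<open>g\<close> gives the complete graph on \<open>V\<close>.\<close>

definition multipartite :: "'a set \<Rightarrow> ('a \<Rightarrow> 'b) \<Rightarrow> ('a \<times> 'a) set" where
  "multipartite V g = {(x, y). x \<in> V \<and> y \<in> V \<and> g x \<noteq> g y}"

text \<open>Block sizes are left free, so that the linear spaces on 25 points are covered as well as
  decompositions into 4-sets.\<close>

definition decomp :: "('a \<times> 'a) set \<Rightarrow> 'a set set \<Rightarrow> bool" where
  "decomp E \<B> \<longleftrightarrow> finite \<B> \<and> irrefl E \<and>
     (\<forall>b\<in>\<B>. \<forall>x\<in>b. \<forall>y\<in>b. x \<noteq> y \<longrightarrow> (x, y) \<in> E) \<and>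
     (\<forall>x y. (x, y) \<in> E \<longrightarrow> (\<exists>b\<in>\<B>. x \<in> b \<and> y \<in> b)) \<and>
     (\<forall>b\<in>\<B>. \<forall>c\<in>\<B>. \<forall>x y. x \<noteq> y \<longrightarrow> {x, y} \<subseteq> b \<inter> c \<longrightarrow> b = c)"

definition decomp4 :: "('a \<times> 'a) set \<Rightarrow> 'a set set \<Rightarrow> bool" where
  "decomp4 E \<B> \<longleftrightarrow> decomp E \<B> \<and> (\<forall>b\<in>\<B>. card b = 4)"

text \<open>Generalizes \<open>J3\<close> from complete graphs to arbitrary graphs, so that the
  intersection numbers of pieces can be added.\<close>

definition triple :: "('a \<times> 'a) set \<Rightarrow> nat \<Rightarrow> bool" where
  "triple E k \<longleftrightarrow> (\<exists>\<B>1 \<B>2 \<B>3. decomp4 E \<B>1 \<and> decomp4 E \<B>2 \<and> decomp4 E \<B>3 \<and>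
     \<B>1 \<inter> \<B>2 = \<B>1 \<inter> \<B>3 \<and> \<B>1 \<inter> \<B>3 = \<B>2 \<inter> \<B>3 \<and> card (\<B>1 \<inter> \<B>2) = k)"

lemma decompI:
  assumes "finite \<B>" "\<And>x. (x, x) \<notin> E"
    and "\<And>b x y. b \<in> \<B> \<Longrightarrow> x \<in> b \<Longrightarrow> y \<in> b \<Longrightarrow> x \<noteq> y \<Longrightarrow> (x, y) \<in> E"
    and "\<And>x y. (x, y) \<in> E \<Longrightarrow> \<exists>b\<in>\<B>. x \<in> b \<and> y \<in> b"
    and "\<And>b c x y. b \<in> \<B> \<Longrightarrow> c \<in> \<B> \<Longrightarrow> x \<noteq> y \<Longrightarrow> x \<in> b \<Longrightarrow> y \<in> b \<Longrightarrow> x \<in> c \<Longrightarrow> y \<in> c \<Longrightarrow> b = c"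
  shows "decomp E \<B>"
proof -
  have "b = c" if "b \<in> \<B>" "c \<in> \<B>" "x \<noteq> y" "{x, y} \<subseteq> b \<inter> c" for b c x y
    by (rule assms(5)[of b c x y]) (use that in auto)
  then show ?thesis unfolding decomp_def irrefl_def using assms(1-4) by simp
qed

lemma decomp_cover:
  assumes "decomp E \<B>" "(x, y) \<in> E"
  obtains b where "b \<in> \<B>" "x \<in> b" "y \<in> b"
proof -
  have "\<exists>b\<in>\<B>. x \<in> b \<and> y \<in> b" using assms by (simp add: decomp_def)
  then show thesis using that by blast
qed

lemma decomp_finite: "decomp E \<B> \<Longrightarrow> finite \<B>"
  by (simp add: decomp_def)

lemma decomp4_decomp: "decomp4 E \<B> \<Longrightarrow> decomp E \<B>"
  by (simp add: decomp4_def)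

lemma decomp4_card: "decomp4 E \<B> \<Longrightarrow> b \<in> \<B> \<Longrightarrow> card b = 4"
  by (simp add: decomp4_def)

lemma decomp_unique:
  assumes "decomp E \<B>" "b \<in> \<B>" "c \<in> \<B>" "x \<noteq> y" "x \<in> b" "y \<in> b" "x \<in> c" "y \<in> c"
  shows "b = c"
proof -
  have "{x, y} \<subseteq> b \<inter> c" using assms by simp
  then show ?thesis using assms(1-4) by (simp add: decomp_def)
qed

lemma decomp_edge:
  assumes "decomp E \<B>" "b \<in> \<B>" "x \<in> b" "y \<in> b" "x \<noteq> y"
  shows "(x, y) \<in> E"
  using assms by (simp add: decomp_def)

lemma decomp_irrefl: "decomp E \<B> \<Longrightarrow> (x, x) \<notin> E"
  by (simp add: decomp_def irrefl_def)

lemma decomp4_edge: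
  assumes "decomp4 E \<B>" "b \<in> \<B>"
  obtains x y where "x \<in> b" "y \<in> b" "(x, y) \<in> E"
proof -
  have "card b = 4" using assms by (simp add: decomp4_def)
  then have "\<not> is_singleton b" "b \<noteq> {}" by (auto simp: is_singleton_altdef)
  then obtain x y where "x \<in> b" "y \<in> b" "x \<noteq> y"
    by (metis is_singletonI' )
  then show thesis using that assms decomp_edge decomp4_decomp by metis
qed

section \<open>Edge-disjoint unions of graphs\<close>

lemma decomp_Un:
  assumes "decomp E \<B>" "decomp E' \<B>'" "E \<inter> E' = {}"
  shows "decomp (E \<union> E') (\<B> \<union> \<B>')"
proof -
  \<comment> \<open>Two points lying in a block of each family would form an edge of both
    graphs.\<close>
  have False if "b \<in> \<B>" "c \<in> \<B>'" "x \<noteq> y" "x \<in> b" "y \<in> b" "x \<in> c" "y \<in> c" for b c x y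
    using decomp_edge[OF assms(1), of b x y] decomp_edge[OF assms(2), of c x y] that assms(3) by blast
  note no = this
  show ?thesis
  proof (rule decompI)
    show "finite (\<B> \<union> \<B>')" using assms(1,2) by (simp add: decomp_finite)
    show "(x, x) \<notin> E \<union> E'" for x
      using decomp_irrefl[OF assms(1)] decomp_irrefl[OF assms(2)] by simp
    show "(x, y) \<in> E \<union> E'" if "b \<in> \<B> \<union> \<B>'" "x \<in> b" "y \<in> b" "x \<noteq> y" for b x y
      using that decomp_edge[OF assms(1), of b x y] decomp_edge[OF assms(2), of b x y] by auto
    show "\<exists>b\<in>\<B> \<union> \<B>'. x \<in> b \<and> y \<in> b" if "(x, y) \<in> E \<union> E'" for x y
      using that decomp_cover[OF assms(1), of x y] decomp_cover[OF assms(2), of x y] by (metis UnCI UnE)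
    show "b = c" if h: "b \<in> \<B> \<union> \<B>'" "c \<in> \<B> \<union> \<B>'" "x \<noteq> y" "x \<in> b" "y \<in> b" "x \<in> c" "y \<in> c"
      for b c x y
    proof -
      consider "b \<in> \<B>" "c \<in> \<B>" | "b \<in> \<B>" "c \<in> \<B>'" | "b \<in> \<B>'" "c \<in> \<B>" | "b \<in> \<B>'" "c \<in> \<B>'"
        using h(1,2) by blast
      then show ?thesis
      proof cases
        case 1
        show ?thesis by (rule decomp_unique[OF assms(1) 1 h(3-7)])
      next
        case 2
        show ?thesis using no[OF 2 h(3-7)] ..
      next
        case 3
        show ?thesis using no[OF 3(2,1) h(3,6,7,4,5)] ..
      next
        case 4
        show ?thesis by (rule decomp_unique[OF assms(2) 4 h(3-7)])
      qed
    qed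
  qed
qed

lemma decomp4_Un:
  assumes "decomp4 E \<B>" "decomp4 E' \<B>'" "E \<inter> E' = {}"
  shows "decomp4 (E \<union> E') (\<B> \<union> \<B>')"
  using assms decomp_Un[of E \<B> E' \<B>'] by (auto simp: decomp4_def)

text \<open>A common block would contain an edge, since it has four points, and this edge would lie
  in both graphs.\<close>

lemma decomp4_disjoint:
  assumes "decomp4 E \<B>" "decomp4 E' \<B>'" "E \<inter> E' = {}"
  shows "\<B> \<inter> \<B>' = {}"
proof (rule ccontr)
  assume "\<B> \<inter> \<B>' \<noteq> {}"
  then obtain b where b: "b \<in> \<B>" "b \<in> \<B>'" by blast
  obtain x y where xy: "x \<in> b" "y \<in> b" "(x, y) \<in> E" using decomp4_edge[OF assms(1) b(1)] .
  then have "x \<noteq> y" using assms(1) decomp_irrefl decomp4_decomp by metis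
  then have "(x, y) \<in> E'" using xy b assms(2) decomp_edge decomp4_decomp by metis
  then show False using xy assms(3) by blast
qed

text \<open>No block of one graph is a block of the other, so mixed intersections such as
  \<open>\<B>1 \<inter> \<C>2\<close> vanish.\<close>

lemma triple_Un:
  assumes "triple E k" "triple E' k'" and EE: "E \<inter> E' = {}"
  shows "triple (E \<union> E') (k + k')"
proof -
  from assms(1) obtain \<B>1 \<B>2 \<B>3 where B: "decomp4 E \<B>1" "decomp4 E \<B>2" "decomp4 E \<B>3"
    "\<B>1 \<inter> \<B>2 = \<B>1 \<inter> \<B>3" "\<B>1 \<inter> \<B>3 = \<B>2 \<inter> \<B>3" "card (\<B>1 \<inter> \<B>2) = k"
    unfolding triple_def by blast
  from assms(2) obtain \<C>1 \<C>2 \<C>3 where C: "decomp4 E' \<C>1" "decomp4 E' \<C>2" "decomp4 E' \<C>3"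
    "\<C>1 \<inter> \<C>2 = \<C>1 \<inter> \<C>3" "\<C>1 \<inter> \<C>3 = \<C>2 \<inter> \<C>3" "card (\<C>1 \<inter> \<C>2) = k'"
    unfolding triple_def by blast
  note disj = decomp4_disjoint[OF B(1) C(1) EE] decomp4_disjoint[OF B(1) C(2) EE]
    decomp4_disjoint[OF B(1) C(3) EE] decomp4_disjoint[OF B(2) C(1) EE]
    decomp4_disjoint[OF B(2) C(2) EE] decomp4_disjoint[OF B(2) C(3) EE]
    decomp4_disjoint[OF B(3) C(1) EE] decomp4_disjoint[OF B(3) C(2) EE]
    decomp4_disjoint[OF B(3) C(3) EE]
  have eq: "(\<B>1 \<union> \<C>1) \<inter> (\<B>2 \<union> \<C>2) = \<B>1 \<inter> \<B>2 \<union> \<C>1 \<inter> \<C>2"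
    "(\<B>1 \<union> \<C>1) \<inter> (\<B>3 \<union> \<C>3) = \<B>1 \<inter> \<B>3 \<union> \<C>1 \<inter> \<C>3"
    "(\<B>2 \<union> \<C>2) \<inter> (\<B>3 \<union> \<C>3) = \<B>2 \<inter> \<B>3 \<union> \<C>2 \<inter> \<C>3"
    using disj by blast+
  have "finite \<B>1" "finite \<C>1" using B(1) C(1) by (simp_all add: decomp4_def decomp_def)
  then have "card (\<B>1 \<inter> \<B>2 \<union> \<C>1 \<inter> \<C>2) = k + k'"
    using disj(1) B(6) C(6) by (subst card_Un_disjoint) auto
  then show ?thesis unfolding triple_def
    using decomp4_Un[OF B(1) C(1) EE] decomp4_Un[OF B(2) C(2) EE] decomp4_Un[OF B(3) C(3) EE]
      eq B(4,5) C(4,5) by metis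
qed

lemma triple_UN:
  assumes "finite I" "\<And>i. i \<in> I \<Longrightarrow> triple (E i) (k i)"
    and "\<And>i j. i \<in> I \<Longrightarrow> j \<in> I \<Longrightarrow> i \<noteq> j \<Longrightarrow> E i \<inter> E j = {}"
  shows "triple (\<Union>i\<in>I. E i) (\<Sum>i\<in>I. k i)"
  using assms
proof (induction I rule: finite_induct)
  case empty
  have "decomp4 {} {}" by (simp add: decomp4_def decomp_def irrefl_def)
  then have "triple {} 0" unfolding triple_def by (metis Int_empty_right card.empty)
  then show ?case by simp
next
  case (insert i I)
  have "E i \<inter> (\<Union>j\<in>I. E j) = {}" using insert.prems(2) insert.hyps(2) by blast
  then have "triple (E i \<union> (\<Union>j\<in>I. E j)) (k i + (\<Sum>j\<in>I. k j))"
    using insert by (intro triple_Un) auto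
  then show ?case using insert.hyps by simp
qed

lemma triple_full:
  assumes "decomp4 E \<B>"
  shows "triple E (card \<B>)"
  unfolding triple_def by (intro exI[of _ \<B>]) (simp add: assms)

section \<open>Renaming of points\<close>

lemma decomp4_image:
  assumes D: "decomp4 (multipartite V g) \<B>" and inj: "inj_on f V"
    and g: "\<And>x y. x \<in> V \<Longrightarrow> y \<in> V \<Longrightarrow> g' (f x) = g' (f y) \<longleftrightarrow> g x = g y"
    and sub: "\<And>b. b \<in> \<B> \<Longrightarrow> b \<subseteq> V"
  shows "decomp4 (multipartite (f ` V) g') ((`) f ` \<B>)"
proof -
  have D1: "decomp (multipartite V g) \<B>" and D2: "\<And>b. b \<in> \<B> \<Longrightarrow> card b = 4"
    using D by (simp_all add: decomp4_def)
  have mem: "f x \<in> f ` b \<longleftrightarrow> x \<in> b" if "b \<in> \<B>" "x \<in> V" for x b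
    using inj sub that by (meson inj_on_image_mem_iff)
  have cover: "\<exists>c\<in>(`) f ` \<B>. f x \<in> c \<and> f y \<in> c"
    if xy: "x \<in> V" "y \<in> V" "g' (f x) \<noteq> g' (f y)" for x y
  proof -
    have "(x, y) \<in> multipartite V g" using xy g by (auto simp: multipartite_def)
    from decomp_cover[OF D1 this] obtain b where "b \<in> \<B>" "x \<in> b" "y \<in> b" .
    then show ?thesis by blast
  qed
  have uniq: "f ` b = f ` c" if bc: "b \<in> \<B>" "c \<in> \<B>" and xy: "x \<noteq> y" "x \<in> f ` b" "y \<in> f ` b" "x \<in> f ` c" "y \<in> f ` c" for b c x y
  proof -
    obtain u v where uv: "u \<in> b" "v \<in> b" "x = f u" "y = f v" using xy by blast
    then have "u \<in> c" "v \<in> c" "u \<noteq> v" using xy bc sub mem by blast+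
    then show ?thesis using decomp_unique[OF D1 bc] uv by metis
  qed
  have card4: "card (f ` b) = 4" if "b \<in> \<B>" for b
    using that sub D2 inj by (metis card_image inj_on_subset)
  have edge: "(f x, f y) \<in> multipartite (f ` V) g'" if "b \<in> \<B>" "x \<in> b" "y \<in> b" "f x \<noteq> f y" for b x y
  proof -
    have "x \<noteq> y" using that(4) by blast
    then have "(x, y) \<in> multipartite V g" by (rule decomp_edge[OF D1 that(1-3)])
    then have xy: "x \<in> V" "y \<in> V" "g x \<noteq> g y" by (simp_all add: multipartite_def)
    then have "g' (f x) \<noteq> g' (f y)" by (simp only: g not_False_eq_True)
    with xy(1,2) show ?thesis by (simp add: multipartite_def)
  qed
  have "decomp (multipartite (f ` V) g') ((`) f ` \<B>)"
  proof (rule decompI)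
    show "finite ((`) f ` \<B>)" using decomp_finite[OF D1] by simp
    show "(x, x) \<notin> multipartite (f ` V) g'" for x by (simp add: multipartite_def)
    show "(x, y) \<in> multipartite (f ` V) g'"
      if c: "c \<in> (`) f ` \<B>" "x \<in> c" "y \<in> c" "x \<noteq> y" for c x y
    proof -
      obtain b where b: "b \<in> \<B>" "c = f ` b" using c(1) by blast
      obtain u where u: "u \<in> b" "x = f u" using c(2) unfolding b(2) by blast
      obtain v where v: "v \<in> b" "y = f v" using c(3) unfolding b(2) by blast
      show ?thesis using edge[OF b(1) u(1) v(1)] c(4) unfolding u(2) v(2) .
    qed
    show "\<exists>c\<in>(`) f ` \<B>. x \<in> c \<and> y \<in> c" if "(x, y) \<in> multipartite (f ` V) g'" for x y
    proof -
      have "x \<in> f ` V" "y \<in> f ` V" and g'xy: "g' x \<noteq> g' y"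
        using that by (simp_all add: multipartite_def)
      then obtain u v where uv: "u \<in> V" "x = f u" "v \<in> V" "y = f v" by (elim imageE)
      show ?thesis using cover[OF uv(1,3)] g'xy unfolding uv(2,4) .
    qed
    show "c = d" if cd: "c \<in> (`) f ` \<B>" "d \<in> (`) f ` \<B>" and
      xy: "x \<noteq> y" "x \<in> c" "y \<in> c" "x \<in> d" "y \<in> d" for c d x y
    proof -
      obtain a b where ab: "c = f ` a" "a \<in> \<B>" "d = f ` b" "b \<in> \<B>" using cd by (elim imageE)
      show ?thesis using uniq[OF ab(2,4)] xy unfolding ab(1,3) .
    qed
  qed
  then show ?thesis using card4 by (auto simp: decomp4_def)
qed

lemma decomp4_multipartite_subset:
  assumes D: "decomp4 (multipartite V g) \<B>" and b: "b \<in> \<B>"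
  shows "b \<subseteq> V"
proof
  fix x assume x: "x \<in> b"
  have "card b = 4" using D b by (simp add: decomp4_def)
  then have "b \<noteq> {x}" by auto
  then obtain y where "y \<in> b" "x \<noteq> y" using x by blast
  then have "(x, y) \<in> multipartite V g" using x D b decomp_edge decomp4_decomp by metis
  then show "x \<in> V" by (simp add: multipartite_def)
qed

text \<open>Taking images under \<open>f\<close> is injective on subsets of \<open>V\<close>, so it
  commutes with intersections of block sets and keeps their sizes.\<close>

lemma triple_image:
  assumes T: "triple (multipartite V g) k" and inj: "inj_on f V"
    and g: "\<And>x y. x \<in> V \<Longrightarrow> y \<in> V \<Longrightarrow> g' (f x) = g' (f y) \<longleftrightarrow> g x = g y"
  shows "triple (multipartite (f ` V) g') k"
proof -
  obtain \<B>1 \<B>2 \<B>3 where B: "decomp4 (multipartite V g) \<B>1" "decomp4 (multipartite V g) \<B>2"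
    "decomp4 (multipartite V g) \<B>3" "\<B>1 \<inter> \<B>2 = \<B>1 \<inter> \<B>3" "\<B>1 \<inter> \<B>3 = \<B>2 \<inter> \<B>3" "card (\<B>1 \<inter> \<B>2) = k"
    using T unfolding triple_def by blast
  note sub = decomp4_multipartite_subset[OF B(1)] decomp4_multipartite_subset[OF B(2)]
    decomp4_multipartite_subset[OF B(3)]
  have injP: "inj_on ((`) f) (Pow V)" using inj by (rule inj_on_image_Pow)
  have S: "\<B>1 \<subseteq> Pow V" "\<B>2 \<subseteq> Pow V" "\<B>3 \<subseteq> Pow V" using sub by blast+
  note I = inj_on_image_Int[OF injP S(1,2)] inj_on_image_Int[OF injP S(1,3)]
    inj_on_image_Int[OF injP S(2,3)]
  have "card ((`) f ` (\<B>1 \<inter> \<B>2)) = k"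
    using B(6) card_image inj_on_subset[OF injP] S(1) by (metis inf.coboundedI1)
  moreover note decomp4_image[OF B(1) inj g sub(1)] decomp4_image[OF B(2) inj g sub(2)]
    decomp4_image[OF B(3) inj g sub(3)]
  ultimately show ?thesis unfolding triple_def using I B(4,5) by metis
qed

section \<open>Designs as decompositions of complete graphs\<close>

lemma decomp4_complete_iff:
  fixes V :: "'a set"
  assumes "finite V"
  shows "decomp4 (multipartite V (\<lambda>x. x)) \<B> \<longleftrightarrow> S24_design (card V) V \<B>"
proof
  assume D: "decomp4 (multipartite V (\<lambda>x. x)) \<B>"
  then have D1: "decomp (multipartite V (\<lambda>x. x)) \<B>" unfolding decomp4_def by blast
  have "\<exists>!B. B \<in> \<B> \<and> P \<subseteq> B" if P: "P \<subseteq> V" "card P = 2" for P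
  proof -
    obtain x y where xy: "P = {x, y}" "x \<noteq> y" using P(2) by (auto simp: card_2_iff)
    then have "(x, y) \<in> multipartite V (\<lambda>x. x)" using P(1) by (auto simp: multipartite_def)
    from decomp_cover[OF D1 this] obtain b where b: "b \<in> \<B>" "x \<in> b" "y \<in> b" .
    show ?thesis
    proof (rule ex1I[of _ b])
      show "b \<in> \<B> \<and> P \<subseteq> b" using b xy(1) by simp
      show "c = b" if "c \<in> \<B> \<and> P \<subseteq> c" for c
        using decomp_unique[OF D1, of c b x y] that b xy by simp
    qed
  qed
  then show "S24_design (card V) V \<B>"
    using assms decomp4_multipartite_subset[OF D] decomp4_card[OF D] by (simp add: S24_design_def)
next
  assume S: "S24_design (card V) V \<B>"
  note S = S[unfolded S24_design_def, THEN conjunct2, THEN conjunct2]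
  have "\<forall>B\<in>\<B>. B \<subseteq> V \<and> card B = 4" by (rule S[THEN conjunct1])
  then have sub: "\<B> \<subseteq> Pow V" and card4: "\<forall>b\<in>\<B>. card b = 4" by blast+
  then have fin: "finite \<B>" using assms by (meson finite_Pow_iff finite_subset)
  have ex1: "\<exists>!B. B \<in> \<B> \<and> {x, y} \<subseteq> B" if "x \<in> V" "y \<in> V" "x \<noteq> y" for x y
    by (rule S[THEN conjunct2, rule_format]) (use that in simp)
  have "decomp (multipartite V (\<lambda>x. x)) \<B>"
  proof (rule decompI[OF fin])
    show "(x, x) \<notin> multipartite V (\<lambda>x. x)" for x by (simp add: multipartite_def)
    show "(x, y) \<in> multipartite V (\<lambda>x. x)" if "b \<in> \<B>" "x \<in> b" "y \<in> b" "x \<noteq> y" for b x y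
      using that sub by (auto simp: multipartite_def)
    show "\<exists>b\<in>\<B>. x \<in> b \<and> y \<in> b" if "(x, y) \<in> multipartite V (\<lambda>x. x)" for x y
    proof -
      have "x \<in> V" "y \<in> V" "x \<noteq> y" using that by (simp_all add: multipartite_def)
      from ex1[OF this] show ?thesis by auto
    qed
    show "b = c" if "b \<in> \<B>" "c \<in> \<B>" "x \<noteq> y" "x \<in> b" "y \<in> b" "x \<in> c" "y \<in> c" for b c x y
    proof -
      have "x \<in> V" "y \<in> V" using that sub by blast+
      from ex1[OF this \<open>x \<noteq> y\<close>] show ?thesis using that by (auto elim: ex1E)
    qed
  qed
  then show "decomp4 (multipartite V (\<lambda>x. x)) \<B>" using card4 by (simp add: decomp4_def)
qed

text \<open>\<open>J3\<close> speaks of sets of natural numbers, so the points are first renamed to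
  an initial segment.\<close>

lemma J3_of_triple:
  fixes V :: "'a set"
  assumes "finite V" "triple (multipartite V (\<lambda>x. x)) k"
  shows "int k \<in> J3 (card V)"
proof -
  obtain f where f: "bij_betw f V {0..<card V}" using ex_bij_betw_finite_nat[OF assms(1)] by blast
  have "inj_on f V" using f by (simp add: bij_betw_def)
  then have "triple (multipartite (f ` V) (\<lambda>x. x)) k"
    by (intro triple_image[OF assms(2)]) (simp_all add: inj_on_eq_iff)
  then have "triple (multipartite {0..<card V} (\<lambda>x. x)) k" using f by (simp add: bij_betw_def)
  then obtain \<B>1 \<B>2 \<B>3 where B: "S24_design (card V) {0..<card V} \<B>1"
    "S24_design (card V) {0..<card V} \<B>2" "S24_design (card V) {0..<card V} \<B>3"
    "\<B>1 \<inter> \<B>2 = \<B>1 \<inter> \<B>3" "\<B>1 \<inter> \<B>3 = \<B>2 \<inter> \<B>3" "card (\<B>1 \<inter> \<B>2) = k"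
    unfolding triple_def decomp4_complete_iff[OF finite_atLeastLessThan] card_atLeastLessThan diff_zero
    by (elim exE conjE)
  show ?thesis unfolding J3_def mem_Collect_eq
    by (intro exI[of _ "{0..<card V}"] exI[of _ \<B>1] exI[of _ \<B>2] exI[of _ \<B>3] conjI B)
      (simp only: B(6))
qed

section \<open>Three-way trades have at least eight blocks\<close>

definition deg :: "'a set set \<Rightarrow> 'a \<Rightarrow> nat" where
  "deg T x = card {b \<in> T. x \<in> b}"

lemma card_4_obtain:
  assumes "card b = 4" "a \<in> b"
  obtains p q r where "b = {a, p, q, r}" "distinct [a, p, q, r]"
proof -
  have "card (b - {a}) = 3" using assms by (simp add: card_Diff_singleton)
  then obtain p q r where "b - {a} = {p, q, r}" "p \<noteq> q" "q \<noteq> r" "p \<noteq> r" by (auto simp: card_3_iff)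
  then show thesis using that[of p q r] assms(2) by auto
qed

text \<open>Two blocks through \<open>x\<close> have no other point in common, so the neighbours of
  \<open>x\<close> are partitioned into groups of three.\<close>

lemma decomp4_degree:
  assumes D: "decomp4 E T"
  shows "E `` {x} = (\<Union>b\<in>{b \<in> T. x \<in> b}. b - {x})" "card (E `` {x}) = 3 * deg T x"
proof -
  note D' = decomp4_decomp[OF D]
  show eq: "E `` {x} = (\<Union>b\<in>{b \<in> T. x \<in> b}. b - {x})"
  proof (intro set_eqI iffI)
    fix y assume "y \<in> E `` {x}"
    then have xy: "(x, y) \<in> E" by simp
    from decomp_cover[OF D' xy] obtain b where "b \<in> T" "x \<in> b" "y \<in> b" .
    moreover have "x \<noteq> y" using xy decomp_irrefl[OF D'] by metis
    ultimately show "y \<in> (\<Union>b\<in>{b \<in> T. x \<in> b}. b - {x})" by blast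
  next
    fix y assume "y \<in> (\<Union>b\<in>{b \<in> T. x \<in> b}. b - {x})"
    then obtain b where b: "b \<in> T" "x \<in> b" "y \<in> b" "x \<noteq> y" by blast
    from decomp_edge[OF D' b] show "y \<in> E `` {x}" by simp
  qed
  have c4: "card b = 4" if "b \<in> T" for b using decomp4_card[OF D that] .
  have "finite T" using decomp_finite[OF D'] .
  have fin: "finite b" if "b \<in> T" for b using c4[OF that] by (metis card.infinite zero_neq_numeral)
  have "card (\<Union>b\<in>{b \<in> T. x \<in> b}. b - {x}) = (\<Sum>b\<in>{b \<in> T. x \<in> b}. card (b - {x}))"
  proof (rule card_UN_disjoint)
    show "\<forall>i\<in>{b \<in> T. x \<in> b}. \<forall>j\<in>{b \<in> T. x \<in> b}. i \<noteq> j \<longrightarrow> (i - {x}) \<inter> (j - {x}) = {}"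
    proof (intro ballI impI)
      fix i j assume ij: "i \<in> {b \<in> T. x \<in> b}" "j \<in> {b \<in> T. x \<in> b}" "i \<noteq> j"
      have False if "y \<in> (i - {x}) \<inter> (j - {x})" for y
        using decomp_unique[OF D', of i j y x] that ij by simp
      then show "(i - {x}) \<inter> (j - {x}) = {}" by blast
    qed
  qed (use \<open>finite T\<close> fin in simp_all)
  also have "\<dots> = (\<Sum>b\<in>{b \<in> T. x \<in> b}. 3)" using c4 by (intro sum.cong) (simp_all add: card_Diff_singleton)
  finally show "card (E `` {x}) = 3 * deg T x" unfolding eq by (simp add: deg_def)
qed

text \<open>The number of neighbours depends on \<open>E\<close> alone.\<close>

lemma decomp4_deg_eq:
  assumes "decomp4 E T" "decomp4 E T'"
  shows "deg T x = deg T' x"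
  using decomp4_degree(2)[OF assms(1), of x] decomp4_degree(2)[OF assms(2), of x] by simp

text \<open>The only block through a point of degree 1 consists of the point and its neighbours, so
  it would belong to both decompositions.\<close>

lemma decomp4_deg_ge_2:
  assumes D: "decomp4 E T" "decomp4 E T'" and disj: "T \<inter> T' = {}" and b: "b \<in> T" "x \<in> b"
  shows "2 \<le> deg T x"
proof (rule ccontr)
  assume "\<not> 2 \<le> deg T x"
  moreover have fin: "finite {b \<in> T. x \<in> b}"
    using decomp_finite[OF decomp4_decomp[OF D(1)]] by simp
  then have "deg T x \<noteq> 0" using b by (auto simp: deg_def)
  ultimately have one: "deg T x = 1" by linarith
  then have "deg T' x = 1" using decomp4_deg_eq[OF D, of x] by simp
  then obtain c where c: "{b \<in> T'. x \<in> b} = {c}" unfolding deg_def by (meson card_1_singletonE)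
  obtain b' where b': "{b \<in> T. x \<in> b} = {b'}" using one unfolding deg_def by (meson card_1_singletonE)
  have "b \<in> {b \<in> T. x \<in> b}" using b by simp
  then have bs: "{b \<in> T. x \<in> b} = {b}" unfolding b' by simp
  have "b - {x} = c - {x}"
    using decomp4_degree(1)[OF D(1), of x] decomp4_degree(1)[OF D(2), of x] unfolding c bs by simp
  moreover have "c \<in> {b \<in> T'. x \<in> b}" unfolding c by simp
  ultimately have "b = c" "c \<in> T'" using b(2) by auto
  then show False using disj b by blast
qed

text \<open>Counting incidences with points of \<open>b\<close>: the block \<open>b\<close> itself
  contributes 4, every other block at most 1.\<close>

lemma decomp4_deg_sum_le:
  assumes D: "decomp4 E T" and b: "b \<in> T"
  shows "(\<Sum>x\<in>b. deg T x) \<le> card T + 3"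
proof -
  note D' = decomp4_decomp[OF D]
  have fin: "finite T" using decomp_finite[OF D'] .
  have "finite b" using decomp4_card[OF D b] by (metis card.infinite zero_neq_numeral)
  have "(\<Sum>x\<in>b. deg T x) = (\<Sum>c\<in>T. card (b \<inter> c))"
    unfolding deg_def using \<open>finite b\<close> fin
    by (intro sum_multicount_gen) (auto simp: Int_def)
  then have sum: "(\<Sum>x\<in>b. deg T x) = card b + (\<Sum>c\<in>T - {b}. card (b \<inter> c))"
    using sum.remove[OF fin b, of "\<lambda>c. card (b \<inter> c)"] by simp
  have "card (b \<inter> c) \<le> 1" if c: "c \<in> T - {b}" for c
  proof -
    have "x = y" if "x \<in> b \<inter> c" "y \<in> b \<inter> c" for x y
      using decomp_unique[OF D', of b c x y] that b c by auto
    then show ?thesis using \<open>finite b\<close> by (simp add: card_le_Suc0_iff_eq)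
  qed
  then have "(\<Sum>c\<in>T - {b}. card (b \<inter> c)) \<le> card (T - {b})"
    using sum_bounded_above[of "T - {b}" "\<lambda>c. card (b \<inter> c)" 1] by simp
  moreover have "card T = Suc (card (T - {b}))" by (rule card.remove[OF fin b])
  ultimately show ?thesis using sum decomp4_card[OF D b] by linarith
qed

text \<open>The two blocks of \<open>T'\<close> through \<open>a\<close> cover the other three
  points of \<open>b\<close>, so one of them contains two of these. It cannot contain the third,
  since it would then equal \<open>b\<close>.\<close>

lemma trade_missed_point:
  assumes D: "decomp4 E T" "decomp4 E T'" and disj: "T \<inter> T' = {}" and b: "b \<in> T" "a \<in> b"
    and two: "deg T a = 2"
  shows "\<exists>d\<in>b. \<exists>c\<in>T'. b - {d} \<subseteq> c \<and> d \<notin> c \<and> 3 \<le> deg T d"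
proof -
  note D1 = decomp4_decomp[OF D(1)] and D2 = decomp4_decomp[OF D(2)]
  have edge: "(x, y) \<in> E" if "x \<in> b" "y \<in> b" "x \<noteq> y" for x y
    using decomp_edge[OF D1 b(1) that] .
  \<comment> \<open>Of the points of \<open>b\<close>, the block \<open>c\<close> misses only
    \<open>r\<close>. A block of \<open>T'\<close> through \<open>r\<close> contains at most one of
    \<open>a\<close>, \<open>p\<close>, \<open>q\<close>, so three blocks through \<open>r\<close>
    are needed to reach them.\<close>
  have *: ?thesis if c: "c \<in> T'" "{a, p, q} \<subseteq> c" and pqr: "b = {a, p, q, r}" "distinct [a, p, q, r]"
    for c p q r
  proof -
    have "r \<notin> c"
    proof
      assume "r \<in> c"
      then have "b \<subseteq> c" using c pqr by simp
      moreover have "card b = 4" "card c = 4"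
        using decomp4_card[OF D(1) b(1)] decomp4_card[OF D(2) c(1)] by simp_all
      ultimately have "b = c" by (metis card_subset_eq card.infinite zero_neq_numeral)
      then show False using disj b c by blast
    qed
    have nb: "(r, a) \<in> E" "(r, p) \<in> E" "(r, q) \<in> E" by (rule edge; use pqr in auto)+
    from decomp_cover[OF D2 nb(1)] obtain ea where ea: "ea \<in> T'" "r \<in> ea" "a \<in> ea" .
    from decomp_cover[OF D2 nb(2)] obtain ep where ep: "ep \<in> T'" "r \<in> ep" "p \<in> ep" .
    from decomp_cover[OF D2 nb(3)] obtain eq where eq: "eq \<in> T'" "r \<in> eq" "q \<in> eq" .
    have no: False if "e \<in> T'" "r \<in> e" "x \<in> e" "y \<in> e" "x \<in> c" "y \<in> c" "x \<noteq> y" for e x y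
      using decomp_unique[OF D2 that(1) c(1) that(7,3,4,5,6)] that(2) \<open>r \<notin> c\<close> by blast
    have "ea \<noteq> ep" "ea \<noteq> eq" "ep \<noteq> eq"
      using no[of ea a p] no[of ea a q] no[of ep p q] ea ep eq c(2) pqr(2) by auto
    then have "card {ea, ep, eq} = 3" by simp
    moreover have "{ea, ep, eq} \<subseteq> {b \<in> T'. r \<in> b}" using ea ep eq by blast
    moreover have "finite {b \<in> T'. r \<in> b}" using decomp_finite[OF D2] by simp
    ultimately have "3 \<le> deg T' r" unfolding deg_def by (metis card_mono)
    then have "3 \<le> deg T r" using decomp4_deg_eq[OF D] by metis
    moreover have "b - {r} \<subseteq> c" using c pqr by auto
    ultimately show ?thesis using \<open>r \<notin> c\<close> c(1) pqr(1) by blast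
  qed
  have "deg T' a = 2" using two decomp4_deg_eq[OF D] by metis
  then obtain c c' where cc: "{b \<in> T'. a \<in> b} = {c, c'}" unfolding deg_def by (meson card_2_iff)
  obtain p q r where pqr: "b = {a, p, q, r}" "distinct [a, p, q, r]"
    using card_4_obtain[OF decomp4_card[OF D(1) b(1)] b(2)] .
  have split: "x \<in> c \<or> x \<in> c'" if "x \<in> b" "x \<noteq> a" for x
  proof -
    have "(a, x) \<in> E" using edge b(2) that by metis
    from decomp_cover[OF D2 this] obtain e where e: "e \<in> T'" "a \<in> e" "x \<in> e" .
    then have "e \<in> {b \<in> T'. a \<in> b}" by simp
    then show ?thesis unfolding cc using e(3) by auto
  qed
  have "c \<in> {b \<in> T'. a \<in> b}" "c' \<in> {b \<in> T'. a \<in> b}" unfolding cc by simp_all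
  then have c: "c \<in> T'" "a \<in> c" "c' \<in> T'" "a \<in> c'" by simp_all
  \<comment> \<open>The argument above also applies with \<open>q\<close> or \<open>p\<close> as the
    missed point.\<close>
  have perm: "b = {a, p, r, q}" "distinct [a, p, r, q]" "b = {a, q, r, p}" "distinct [a, q, r, p]"
    using pqr by auto
  have "p \<in> c \<or> p \<in> c'" "q \<in> c \<or> q \<in> c'" "r \<in> c \<or> r \<in> c'"
    by (rule split; use pqr in auto)+
  then consider "{a, p, q} \<subseteq> c" | "{a, p, q} \<subseteq> c'" | "{a, p, r} \<subseteq> c" | "{a, p, r} \<subseteq> c'"
    | "{a, q, r} \<subseteq> c" | "{a, q, r} \<subseteq> c'"
    using c by auto
  then show ?thesis
    by cases (fact *[OF c(1) _ pqr] *[OF c(3) _ pqr] *[OF c(1) _ perm(1,2)] *[OF c(3) _ perm(1,2)]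
      *[OF c(1) _ perm(3,4)] *[OF c(3) _ perm(3,4)])+
qed

text \<open>
  The two blocks \<open>c\<close> and \<open>c'\<close> extend \<open>b - {d}\<close> by distinct points \<open>e\<close> and \<open>e'\<close>, and the
  second blocks of \<open>T1\<close> through \<open>a\<close> and through \<open>a'\<close> both contain \<open>e\<close> and \<open>e'\<close>.
\<close>
lemma trade_missed_points_differ:
  assumes D: "decomp4 E T1" "decomp4 E T2" "decomp4 E T3" and disj: "T2 \<inter> T3 = {}"
    and b: "b \<in> T1" "d \<in> b" and c: "c \<in> T2" "b - {d} \<subseteq> c" "d \<notin> c"
    and c': "c' \<in> T3" "b - {d} \<subseteq> c'" "d \<notin> c'"
    and a: "a \<in> b - {d}" "deg T1 a = 2" and a': "a' \<in> b - {d}" "deg T1 a' = 2" and "a \<noteq> a'"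
  shows False
proof -
  note D1 = decomp4_decomp[OF D(1)] and D2 = decomp4_decomp[OF D(2)] and D3 = decomp4_decomp[OF D(3)]
  have extra: "\<exists>e. e \<notin> b \<and> f = insert e (b - {d})"
    if f: "card f = 4" "b - {d} \<subseteq> f" "d \<notin> f" for f
  proof -
    have "card b = 4" using decomp4_card[OF D(1) b(1)] .
    then have "card (b - {d}) = 3" using b(2) by (simp add: card_Diff_singleton)
    moreover have "finite f" "finite (b - {d})"
      using f(1) \<open>card (b - {d}) = 3\<close> by (metis card.infinite zero_neq_numeral)+
    ultimately have "card (f - (b - {d})) = 1" using f by (simp add: card_Diff_subset)
    then obtain e where "f - (b - {d}) = {e}" by (meson card_1_singletonE)
    then show ?thesis using f(2,3) by (intro exI[of _ e]) blast
  qed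
  obtain e where e: "e \<notin> b" "c = insert e (b - {d})"
    using extra[OF decomp4_card[OF D(2) c(1)] c(2,3)] by (elim exE conjE)
  obtain e' where e': "e' \<notin> b" "c' = insert e' (b - {d})"
    using extra[OF decomp4_card[OF D(3) c'(1)] c'(2,3)] by (elim exE conjE)
  have "c \<noteq> c'" using c(1) c'(1) disj by blast
  then have "e \<noteq> e'" using e(2) e'(2) by blast
  have block: "\<exists>g\<in>T1. {x, e, e'} \<subseteq> g" if x: "x \<in> b - {d}" "deg T1 x = 2" for x
  proof -
    have "x \<noteq> e" "x \<noteq> e'" using x(1) e(1) e'(1) by auto
    have "(x, e) \<in> E" by (rule decomp_edge[OF D2 c(1)]) (use x(1) e(2) \<open>x \<noteq> e\<close> in auto)
    from decomp_cover[OF D1 this] obtain g where g: "g \<in> T1" "x \<in> g" "e \<in> g" .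
    have "(x, e') \<in> E" by (rule decomp_edge[OF D3 c'(1)]) (use x(1) e'(2) \<open>x \<noteq> e'\<close> in auto)
    from decomp_cover[OF D1 this] obtain g' where g': "g' \<in> T1" "x \<in> g'" "e' \<in> g'" .
    have "g = g'"
    proof (rule ccontr)
      assume "g \<noteq> g'"
      moreover have "b \<noteq> g" "b \<noteq> g'" using g(3) g'(3) e(1) e'(1) by blast+
      ultimately have "card {b, g, g'} = 3" by simp
      moreover have "{b, g, g'} \<subseteq> {b \<in> T1. x \<in> b}" using b(1) x(1) g(1,2) g'(1,2) by simp
      moreover have "finite {b \<in> T1. x \<in> b}" using decomp_finite[OF D1] by simp
      ultimately have "3 \<le> deg T1 x" unfolding deg_def by (metis card_mono)
      then show False using x(2) by simp
    qed
    then show ?thesis using g g' by (intro bexI[of _ g]) simp_all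
  qed
  obtain g where g: "g \<in> T1" "{a, e, e'} \<subseteq> g" using block[OF a] by (elim bexE)
  obtain g' where g': "g' \<in> T1" "{a', e, e'} \<subseteq> g'" using block[OF a'] by (elim bexE)
  \<comment> \<open>Both blocks contain \<open>e\<close> and \<open>e'\<close>, so they coincide;
    then they share \<open>a\<close> and \<open>a'\<close> with \<open>b\<close>, although
    \<open>e\<close> is not in \<open>b\<close>.\<close>
  have "g = g'" by (rule decomp_unique[OF D1 g(1) g'(1) \<open>e \<noteq> e'\<close>]) (use g(2) g'(2) in simp_all)
  then have "g = b"
    by (intro decomp_unique[OF D1 g(1) b(1) \<open>a \<noteq> a'\<close>]) (use g(2) g'(2) a(1) a'(1) in simp_all)
  then show False using g(2) e(1) by simp
qed

lemma three_way_trade_card_ge_8: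
  assumes D: "decomp4 E T1" "decomp4 E T2" "decomp4 E T3"
    and disj: "T1 \<inter> T2 = {}" "T1 \<inter> T3 = {}" "T2 \<inter> T3 = {}" and ne: "T1 \<noteq> {}"
  shows "8 \<le> card T1"
proof (rule ccontr)
  assume "\<not> 8 \<le> card T1"
  then have le7: "card T1 \<le> 7" by simp
  have deg2: "2 \<le> deg T1 x" if "b \<in> T1" "x \<in> b" for b x
    using decomp4_deg_ge_2[OF D(1,2) disj(1) that] .
  have fin: "finite T1" using decomp_finite[OF decomp4_decomp[OF D(1)]] .
  have block: "card T1 = 7 \<and> card {x \<in> b. deg T1 x = 3} = 2" if b: "b \<in> T1" for b
  proof -
    have c4: "card b = 4" using decomp4_card[OF D(1) b] .
    have sum: "(\<Sum>x\<in>b. deg T1 x) \<le> card T1 + 3" by (rule decomp4_deg_sum_le[OF D(1) b])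
    have sum4: "(\<Sum>x\<in>b. deg T1 x) = deg T1 w + deg T1 x + deg T1 y + deg T1 z"
      if "b = {w, x, y, z}" "distinct [w, x, y, z]" for w x y z
      using that by simp
    \<comment> \<open>The degrees in \<open>b\<close> sum to at most 10, while four degrees of at
      least 3 would sum to 12.\<close>
    have "\<exists>a\<in>b. deg T1 a = 2"
    proof (rule ccontr)
      assume no: "\<not> ?thesis"
      have "3 \<le> deg T1 x" if "x \<in> b" for x
        using deg2[OF b that] no that by (metis le_antisym not_less_eq_eq numeral_2_eq_2 numeral_3_eq_3)
      then have "3 * card b \<le> (\<Sum>x\<in>b. deg T1 x)"
        using sum_bounded_below[of b 3 "deg T1"] by (simp add: mult.commute)
      then show False using sum le7 c4 by simp
    qed
    then obtain a where a: "a \<in> b" "deg T1 a = 2" by blast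
    obtain d c where d: "d \<in> b" "3 \<le> deg T1 d" and c: "c \<in> T2" "b - {d} \<subseteq> c" "d \<notin> c"
      using trade_missed_point[OF D(1,2) disj(1) b a] by (elim bexE conjE)
    obtain d' c' where d': "d' \<in> b" "3 \<le> deg T1 d'" and c': "c' \<in> T3" "b - {d'} \<subseteq> c'" "d' \<notin> c'"
      using trade_missed_point[OF D(1,3) disj(2) b a] by (elim bexE conjE)
    \<comment> \<open>If both sets missed \<open>d\<close>, the other three degrees would sum to at
      most 7, so two of them would be 2, which \<open>trade_missed_points_differ\<close>
      excludes.\<close>
    have "d \<noteq> d'"
    proof
      assume "d = d'"
      obtain p q r where pqr: "b = {d, p, q, r}" "distinct [d, p, q, r]"
        using card_4_obtain[OF c4 d(1)] .
      have "deg T1 d + deg T1 p + deg T1 q + deg T1 r \<le> 10" using sum sum4[OF pqr] le7 by simp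
      moreover have "2 \<le> deg T1 p" "2 \<le> deg T1 q" "2 \<le> deg T1 r" using deg2[OF b] pqr(1) by simp_all
      ultimately consider "deg T1 p = 2" "deg T1 q = 2" | "deg T1 p = 2" "deg T1 r = 2"
        | "deg T1 q = 2" "deg T1 r = 2"
        using d(2) by linarith
      moreover note * = trade_missed_points_differ[OF D disj(3) b d(1) c c'[folded \<open>d = d'\<close>]]
      have mem: "p \<in> b - {d}" "q \<in> b - {d}" "r \<in> b - {d}" "p \<noteq> q" "p \<noteq> r" "q \<noteq> r"
        using pqr by auto
      ultimately show False
        by cases (use *[OF mem(1) _ mem(2) _ mem(4)] *[OF mem(1) _ mem(3) _ mem(5)]
          *[OF mem(2) _ mem(3) _ mem(6)] in blast)+
    qed
    obtain p q r where pqr: "b = {d, p, q, r}" "distinct [d, p, q, r]"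
      using card_4_obtain[OF c4 d(1)] .
    have ge: "2 \<le> deg T1 p" "2 \<le> deg T1 q" "2 \<le> deg T1 r" using deg2[OF b] pqr(1) by simp_all
    have le: "deg T1 d + deg T1 p + deg T1 q + deg T1 r \<le> card T1 + 3" using sum sum4[OF pqr] by simp
    have "d' = p \<or> d' = q \<or> d' = r" using d'(1) \<open>d \<noteq> d'\<close> pqr(1) by simp
    then have "3 \<le> deg T1 p \<or> 3 \<le> deg T1 q \<or> 3 \<le> deg T1 r" using d'(2) by metis
    \<comment> \<open>Two degrees of at least 3 and two of at least 2 already reach the bound 10, so
      equality holds throughout.\<close>
    then have "card T1 = 7" "deg T1 d = 3"
      and cs: "deg T1 p = 3 \<and> deg T1 q = 2 \<and> deg T1 r = 2 \<or> deg T1 p = 2 \<and> deg T1 q = 3 \<and> deg T1 r = 2 \<or>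
        deg T1 p = 2 \<and> deg T1 q = 2 \<and> deg T1 r = 3"
      using ge le le7 d(2) by linarith+
    have "{x \<in> b. deg T1 x = 3} = {d, p} \<or> {x \<in> b. deg T1 x = 3} = {d, q} \<or> {x \<in> b. deg T1 x = 3} = {d, r}"
      using cs \<open>deg T1 d = 3\<close> unfolding pqr(1) by (elim disjE) auto
    then have "card {x \<in> b. deg T1 x = 3} = 2" using pqr(2) by (elim disjE) simp_all
    then show ?thesis using \<open>card T1 = 7\<close> by simp
  qed
  \<comment> \<open>Incidences with points of degree 3 are counted in two ways: two for each of the
    seven blocks, three for each point.\<close>
  define X where "X = {x \<in> \<Union>T1. deg T1 x = 3}"
  have "finite b" if "b \<in> T1" for b
    using decomp4_card[OF D(1) that] by (metis card.infinite zero_neq_numeral)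
  then have "finite X" using fin unfolding X_def by simp
  have "(\<Sum>x\<in>X. card {b \<in> T1. x \<in> b}) = 2 * card T1"
  proof (rule sum_multicount[OF \<open>finite X\<close> fin], rule ballI)
    fix b assume b: "b \<in> T1"
    then have "{x \<in> X. x \<in> b} = {x \<in> b. deg T1 x = 3}" unfolding X_def by blast
    then show "card {x \<in> X. x \<in> b} = 2" using block[OF b] by simp
  qed
  moreover have "(\<Sum>x\<in>X. card {b \<in> T1. x \<in> b}) = (\<Sum>x\<in>X. 3)"
    by (intro sum.cong) (simp_all add: X_def deg_def)
  moreover have "card T1 = 7" using block ne by blast
  ultimately have "3 * card X = 14" by simp
  then show False by presburger
qed

section \<open>The upper bound for designs on 76 points\<close>

lemma S24_design_complete:
  assumes "S24_design v V \<B>"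
  shows "decomp4 (multipartite V (\<lambda>x. x)) \<B>" "finite V" "card V = v"
proof -
  show fin: "finite V" and card: "card V = v" using assms by (simp_all add: S24_design_def)
  show "decomp4 (multipartite V (\<lambda>x. x)) \<B>"
    using assms unfolding decomp4_complete_iff[OF fin] card .
qed

text \<open>Incidences are counted by points and by blocks; the \<open>v - 1\<close> neighbours of a
  point come in threes.\<close>

lemma S24_design_card_blocks:
  assumes "S24_design v V \<B>"
  shows "12 * card \<B> = v * (v - 1)"
proof -
  note D = S24_design_complete(1)[OF assms] and fin = S24_design_complete(2)[OF assms]
    and v = S24_design_complete(3)[OF assms]
  have "3 * deg \<B> x = v - 1" if "x \<in> V" for x
  proof -
    have "multipartite V (\<lambda>x. x) `` {x} = V - {x}" using that by (auto simp: multipartite_def)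
    then show ?thesis using decomp4_degree(2)[OF D, of x] fin that v by (simp add: card_Diff_singleton)
  qed
  then have "3 * (\<Sum>x\<in>V. deg \<B> x) = v * (v - 1)" by (simp add: sum_distrib_left v)
  moreover have "(\<Sum>x\<in>V. deg \<B> x) = 4 * card \<B>" unfolding deg_def
  proof (rule sum_multicount[OF fin decomp_finite[OF decomp4_decomp[OF D]]], rule ballI)
    fix b assume b: "b \<in> \<B>"
    then have "{x \<in> V. x \<in> b} = b" using decomp4_multipartite_subset[OF D b] by blast
    then show "card {x \<in> V. x \<in> b} = 4" using decomp4_card[OF D b] by simp
  qed
  ultimately show ?thesis by simp
qed

text \<open>Different blocks share no pair of points, so deleting blocks frees just their own pairs.
  The remaining graph depends only on \<open>E\<close> and \<open>\<C>\<close>, hence is the same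
  for all designs containing \<open>\<C>\<close>.\<close>

lemma decomp4_Diff:
  assumes D: "decomp4 E \<B>" and sub: "\<C> \<subseteq> \<B>"
  shows "decomp4 (E - (\<Union>c\<in>\<C>. c \<times> c)) (\<B> - \<C>)"
proof -
  note D' = decomp4_decomp[OF D]
  have "decomp (E - (\<Union>c\<in>\<C>. c \<times> c)) (\<B> - \<C>)"
  proof (rule decompI)
    show "finite (\<B> - \<C>)" using decomp_finite[OF D'] by simp
    show "(x, x) \<notin> E - (\<Union>c\<in>\<C>. c \<times> c)" for x using decomp_irrefl[OF D'] by simp
    show "(x, y) \<in> E - (\<Union>c\<in>\<C>. c \<times> c)" if b: "b \<in> \<B> - \<C>" "x \<in> b" "y \<in> b" "x \<noteq> y" for b x y
    proof -
      have "\<not> (x \<in> c \<and> y \<in> c)" if "c \<in> \<C>" for c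
        using decomp_unique[OF D', of b c x y] that b sub by blast
      moreover have "(x, y) \<in> E" by (rule decomp_edge[OF D', of b]) (use b in simp_all)
      ultimately show ?thesis by simp
    qed
    show "\<exists>b\<in>\<B> - \<C>. x \<in> b \<and> y \<in> b" if xy: "(x, y) \<in> E - (\<Union>c\<in>\<C>. c \<times> c)" for x y
    proof -
      have "(x, y) \<in> E" using xy by simp
      from decomp_cover[OF D' this] obtain b where b: "b \<in> \<B>" "x \<in> b" "y \<in> b" .
      then have "b \<notin> \<C>" using xy by auto
      then show ?thesis using b by (intro bexI[of _ b]) simp_all
    qed
    show "b = c" if "b \<in> \<B> - \<C>" "c \<in> \<B> - \<C>" "x \<noteq> y" "x \<in> b" "y \<in> b" "x \<in> c" "y \<in> c" for b c x y
      by (rule decomp_unique[OF D', of b c x y]) (use that in simp_all)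
  qed
  then show ?thesis using D by (simp add: decomp4_def)
qed

text \<open>Without the common blocks, the three designs decompose one graph in pairwise disjoint
  ways, so \<open>three_way_trade_card_ge_8\<close> applies unless nothing remains.\<close>

lemma J3_76_bound:
  assumes "k \<in> J3 76"
  shows "0 \<le> k \<and> (k \<le> 467 \<or> k = 475)"
proof -
  obtain V :: "nat set" and \<B>1 \<B>2 \<B>3 where S: "S24_design 76 V \<B>1" "S24_design 76 V \<B>2" "S24_design 76 V \<B>3"
    and eq: "\<B>1 \<inter> \<B>2 = \<B>1 \<inter> \<B>3" "\<B>1 \<inter> \<B>3 = \<B>2 \<inter> \<B>3" and k: "int (card (\<B>1 \<inter> \<B>2)) = k"
    using assms unfolding J3_def by blast
  note D = S24_design_complete(1)[OF S(1)] S24_design_complete(1)[OF S(2)]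
    S24_design_complete(1)[OF S(3)]
  define \<C> where "\<C> = \<B>1 \<inter> \<B>2"
  have sub: "\<C> \<subseteq> \<B>1" "\<C> \<subseteq> \<B>2" "\<C> \<subseteq> \<B>3" unfolding \<C>_def using eq by blast+
  have disj: "(\<B>1 - \<C>) \<inter> (\<B>2 - \<C>) = {}" "(\<B>1 - \<C>) \<inter> (\<B>3 - \<C>) = {}" "(\<B>2 - \<C>) \<inter> (\<B>3 - \<C>) = {}"
    unfolding \<C>_def using eq by blast+
  have fin: "finite \<B>1" using decomp_finite[OF decomp4_decomp[OF D(1)]] .
  have "card \<B>1 = 475" using S24_design_card_blocks[OF S(1)] by simp
  then have le: "card \<C> \<le> 475" and diff: "card (\<B>1 - \<C>) = 475 - card \<C>"
    using card_mono[OF fin sub(1)] card_Diff_subset[OF finite_subset[OF sub(1) fin] sub(1)] by simp_all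
  have "8 \<le> card (\<B>1 - \<C>)" if "\<B>1 - \<C> \<noteq> {}"
    by (rule three_way_trade_card_ge_8[OF decomp4_Diff[OF D(1) sub(1)] decomp4_Diff[OF D(2) sub(2)]
          decomp4_Diff[OF D(3) sub(3)] disj that])
  moreover have "card (\<B>1 - \<C>) = 0" if "\<B>1 - \<C> = {}" unfolding that by simp
  ultimately have "card \<C> \<le> 467 \<or> card \<C> = 475" using le diff by linarith
  then show ?thesis using k unfolding \<C>_def by linarith
qed

section \<open>Decompositions given by lists\<close>

text \<open>
  Sorting the neighbours of each point checks existence and uniqueness of the block through two
  points at once.
\<close>
definition blocks_ok :: "nat \<Rightarrow> (nat \<Rightarrow> nat) \<Rightarrow> nat list list \<Rightarrow> bool" where
  "blocks_ok n g L \<longleftrightarrow> list_all (list_all (\<lambda>x. x < n)) L \<and>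
     list_all (\<lambda>x. sort (concat (map (filter (\<lambda>y. y \<noteq> x)) (filter (\<lambda>b. List.member b x) L))) =
       filter (\<lambda>y. g x \<noteq> g y) [0..<n]) [0..<n]"

text \<open>A strictly increasing list is determined by its set, so blocks can be compared as
  lists.\<close>

definition sized_sorted :: "nat \<Rightarrow> nat list list \<Rightarrow> bool" where
  "sized_sorted m = list_all (\<lambda>b. length b = m \<and> sorted_wrt (<) b)"

definition disjoint_lists :: "nat list list \<Rightarrow> nat list list \<Rightarrow> bool" where
  "disjoint_lists K L \<longleftrightarrow> list_all (\<lambda>b. \<not> List.member L b) K"

lemma distinct_concat_map_eq:
  assumes "distinct (concat (map f xs))" "a \<in> set xs" "b \<in> set xs" "y \<in> set (f a)" "y \<in> set (f b)"
  shows "a = b"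
  using assms by (induction xs) auto

lemma decomp_of_blocks_ok:
  assumes "blocks_ok n g L"
  shows "decomp (multipartite {..<n} g) (set ` set L)"
proof -
  have ltn: "x < n" if "b \<in> set L" "x \<in> set b" for b x
    using assms that unfolding blocks_ok_def by (auto simp: list_all_iff)
  have nb: "sort (concat (map (filter (\<lambda>y. y \<noteq> x)) (filter (\<lambda>b. x \<in> set b) L))) =
      filter (\<lambda>y. g x \<noteq> g y) [0..<n]" (is "sort (?N x) = _") if "x < n" for x
    using assms that unfolding blocks_ok_def by (simp add: list_all_iff)
  \<comment> \<open>The equality of lists is used twice: comparing sets shows that exactly the edges
    are covered, and distinctness that no pair is covered twice.\<close>
  have set_nb: "set (?N x) = {y. y < n \<and> g x \<noteq> g y}" if "x < n" for x
    using arg_cong[OF nb[OF that], of set] by (simp only: set_sort set_filter) auto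
  have dist_nb: "distinct (?N x)" if "x < n" for x
    using arg_cong[OF nb[OF that], of distinct] by (simp only: distinct_sort) simp
  have edge: "(x, y) \<in> multipartite {..<n} g"
    if "b \<in> set L" "x \<in> set b" "y \<in> set b" "x \<noteq> y" for b x y
  proof -
    have "y \<in> set (?N x)" using that by auto
    then show ?thesis using set_nb ltn that by (auto simp: multipartite_def)
  qed
  have cover: "\<exists>b\<in>set L. x \<in> set b \<and> y \<in> set b" if "(x, y) \<in> multipartite {..<n} g" for x y
  proof -
    have "x < n" "y < n" "g x \<noteq> g y" using that by (auto simp: multipartite_def)
    then have "y \<in> set (?N x)" using set_nb by blast
    then show ?thesis by auto
  qed
  have unique: "b = c" if b: "b \<in> set L" "x \<in> set b" "y \<in> set b" and c: "c \<in> set L" "x \<in> set c" "y \<in> set c"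
    and "x \<noteq> y" for b c x y
    by (rule distinct_concat_map_eq[OF dist_nb[OF ltn[OF b(1,2)]], where y = y]) (use that in auto)
  show ?thesis
  proof (rule decompI)
    show "finite (set ` set L)" by simp
    show "(x, x) \<notin> multipartite {..<n} g" for x by (simp add: multipartite_def)
    show "(x, y) \<in> multipartite {..<n} g" if "b \<in> set ` set L" "x \<in> b" "y \<in> b" "x \<noteq> y" for b x y
      using that(1) by (rule imageE) (use that edge in simp)
    show "\<exists>b\<in>set ` set L. x \<in> b \<and> y \<in> b" if "(x, y) \<in> multipartite {..<n} g" for x y
      using cover[OF that] by simp
    show "b = c" if bc: "b \<in> set ` set L" "c \<in> set ` set L"
      and xy: "x \<noteq> y" "x \<in> b" "y \<in> b" "x \<in> c" "y \<in> c" for b c x y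
    proof -
      obtain u v where "b = set u" "u \<in> set L" "c = set v" "v \<in> set L" using bc by (elim imageE)
      with unique[of u x y v] xy show ?thesis by simp
    qed
  qed
qed

lemma sized_sorted_sets:
  assumes "sized_sorted m L"
  shows "inj_on set (set L)" "\<And>b. b \<in> set L \<Longrightarrow> card (set b) = m"
proof -
  have L: "length b = m \<and> sorted_wrt (<) b" if "b \<in> set L" for b
    using assms that unfolding sized_sorted_def list_all_iff by blast
  show "inj_on set (set L)" using L by (intro inj_onI) (blast intro: strict_sorted_equal)
  show "card (set b) = m" if "b \<in> set L" for b
    using L[OF that] distinct_card[of b] by (simp add: strict_sorted_iff)
qed

text \<open>As \<open>X\<close>, \<open>Y\<close>, \<open>Z\<close> are pairwise disjoint, any two
  of the decompositions share exactly \<open>C\<close>. Empty \<open>X\<close>, \<open>Y\<close>,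
  \<open>Z\<close> give the full intersection number.\<close>

lemma triple_of_lists:
  fixes C X Y Z :: "nat list list"
  assumes ok: "blocks_ok n g (C @ X)" "blocks_ok n g (C @ Y)" "blocks_ok n g (C @ Z)"
    and four: "sized_sorted 4 (C @ X @ Y @ Z)" and C: "distinct C" "length C = k"
    and disj: "disjoint_lists X Y" "disjoint_lists X Z" "disjoint_lists Y Z"
  shows "triple (multipartite {..<n} g) k"
proof -
  let ?S = "\<lambda>L. set ` set L"
  have D: "decomp4 (multipartite {..<n} g) (?S (C @ L))"
    if "blocks_ok n g (C @ L)" "set L \<subseteq> set X \<union> set Y \<union> set Z" for L
  proof -
    have "card (set b) = 4" if "b \<in> set (C @ L)" for b
      using sized_sorted_sets(2)[OF four, of b] that \<open>set L \<subseteq> _\<close> by auto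
    then show ?thesis using decomp_of_blocks_ok[OF that(1)] by (simp add: decomp4_def)
  qed
  have inj: "inj_on set (set (C @ X @ Y @ Z))" using four by (rule sized_sorted_sets(1))
  have int: "?S (C @ L) \<inter> ?S (C @ M) = ?S C"
    if "disjoint_lists L M" "set L \<subseteq> set X \<union> set Y \<union> set Z" "set M \<subseteq> set X \<union> set Y \<union> set Z" for L M
  proof -
    have "set L \<inter> set M = {}" using that(1) by (auto simp: disjoint_lists_def list_all_iff)
    moreover have "set (C @ L) \<subseteq> set (C @ X @ Y @ Z)" "set (C @ M) \<subseteq> set (C @ X @ Y @ Z)"
      using that by auto
    ultimately have "?S (C @ L) \<inter> ?S (C @ M) = set ` (set (C @ L) \<inter> set (C @ M))"
      using inj_on_image_Int[OF inj] by metis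
    also have "set (C @ L) \<inter> set (C @ M) = set C" using \<open>set L \<inter> set M = {}\<close> by auto
    finally show ?thesis .
  qed
  have "card (?S C) = k"
    using C inj by (subst card_image) (auto simp: distinct_card inj_on_Un)
  moreover have "?S (C @ X) \<inter> ?S (C @ Y) = ?S C" "?S (C @ X) \<inter> ?S (C @ Z) = ?S C"
    "?S (C @ Y) \<inter> ?S (C @ Z) = ?S C"
    by (intro int disj; blast)+
  moreover have "decomp4 (multipartite {..<n} g) (?S (C @ X))"
    "decomp4 (multipartite {..<n} g) (?S (C @ Y))" "decomp4 (multipartite {..<n} g) (?S (C @ Z))"
    by (intro D ok; blast)+
  ultimately show ?thesis unfolding triple_def
    by (intro exI[of _ "?S (C @ X)"] exI[of _ "?S (C @ Y)"] exI[of _ "?S (C @ Z)"] conjI) simp_all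
qed

section \<open>Tripling the points of a linear space\<close>

text \<open>The three points over \<open>p\<close> are \<open>Some (p, i)\<close> with \<open>i < 3\<close>; the point at infinity is \<open>None\<close>.\<close>

definition inflate :: "nat set \<Rightarrow> (nat \<times> nat) option set" where
  "inflate b = Some ` (b \<times> {..<3})"

text \<open>Each point is labelled by the point below it, so points of one fibre are not
  joined.\<close>

definition line_edges :: "nat set \<Rightarrow> ((nat \<times> nat) option \<times> (nat \<times> nat) option) set" where
  "line_edges b = multipartite (inflate b) (map_option fst)"

definition cone_edges :: "nat set \<Rightarrow> ((nat \<times> nat) option \<times> (nat \<times> nat) option) set" where
  "cone_edges b = multipartite (insert None (inflate b)) (\<lambda>x. x)"

lemma line_edges_simps [simp]:
  "(Some (p, i), Some (q, j)) \<in> line_edges b \<longleftrightarrow> p \<in> b \<and> q \<in> b \<and> i < 3 \<and> j < 3 \<and> p \<noteq> q"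
  "(None, x) \<notin> line_edges b" "(x, None) \<notin> line_edges b"
  by (auto simp: line_edges_def multipartite_def inflate_def)

lemma cone_edges_simps [simp]:
  "(Some (p, i), Some (q, j)) \<in> cone_edges b \<longleftrightarrow>
     p \<in> b \<and> q \<in> b \<and> i < 3 \<and> j < 3 \<and> (p, i) \<noteq> (q, j)"
  "(None, Some (q, j)) \<in> cone_edges b \<longleftrightarrow> q \<in> b \<and> j < 3"
  "(Some (q, j), None) \<in> cone_edges b \<longleftrightarrow> q \<in> b \<and> j < 3"
  "(None, None) \<notin> cone_edges b"
  by (auto simp: cone_edges_def multipartite_def inflate_def)

text \<open>The numbering makes \<open>n div 3\<close> select the fibre, matching the listed
  decompositions, whose classes are those of \<open>x div 3\<close>.\<close>

lemma inflate_bij: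
  assumes "finite b" "card b = m"
  obtains h where "inj_on (\<lambda>n. (h (n div 3), n mod 3)) {..<3 * m}"
    "inflate b = (\<lambda>n. Some (h (n div 3), n mod 3)) ` {..<3 * m}" "inj_on h {..<m}"
proof -
  obtain h where h: "bij_betw h {0..<m} b" using ex_bij_betw_nat_finite[OF assms(1)] assms(2) by blast
  then have inj: "inj_on h {..<m}" and im: "b = h ` {..<m}" by (simp_all add: bij_betw_def atLeast0LessThan)
  show thesis
  proof
    show "inj_on h {..<m}" by (rule inj)
    show "inj_on (\<lambda>n. (h (n div 3), n mod 3)) {..<3 * m}"
    proof (rule inj_onI)
      fix x y assume xy: "x \<in> {..<3 * m}" "y \<in> {..<3 * m}"
        "(h (x div 3), x mod 3) = (h (y div 3), y mod 3)"
      then have "x div 3 \<in> {..<m}" "y div 3 \<in> {..<m}" "h (x div 3) = h (y div 3)" by auto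
      then have "x div 3 = y div 3" using inj by (simp add: inj_on_eq_iff)
      moreover have "x mod 3 = y mod 3" using xy(3) by simp
      ultimately show "x = y" by (metis div_mult_mod_eq)
    qed
    show "inflate b = (\<lambda>n. Some (h (n div 3), n mod 3)) ` {..<3 * m}"
    proof (rule set_eqI, rule iffI)
      fix z assume "z \<in> inflate b"
      then obtain r i where z: "z = Some (h r, i)" "r < m" "i < 3" unfolding inflate_def im by auto
      then have "(3 * r + i) div 3 = r" "(3 * r + i) mod 3 = i" "3 * r + i < 3 * m" by auto
      with z(1) show "z \<in> (\<lambda>n. Some (h (n div 3), n mod 3)) ` {..<3 * m}"
        by (intro image_eqI[of _ _ "3 * r + i"]) simp_all
    next
      fix z assume "z \<in> (\<lambda>n. Some (h (n div 3), n mod 3)) ` {..<3 * m}"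
      then show "z \<in> inflate b" unfolding inflate_def im by auto
    qed
  qed
qed

lemma triple_line_edges:
  assumes "triple (multipartite {..<3 * m} (\<lambda>x. x div 3)) k" "finite b" "card b = m"
  shows "triple (line_edges b) k"
proof -
  obtain h where h: "inj_on (\<lambda>n. (h (n div 3), n mod 3)) {..<3 * m}"
    "inflate b = (\<lambda>n. Some (h (n div 3), n mod 3)) ` {..<3 * m}" "inj_on h {..<m}"
    using inflate_bij[OF assms(2,3)] .
  show ?thesis unfolding line_edges_def h(2)
  proof (rule triple_image[OF assms(1)])
    show "inj_on (\<lambda>n. Some (h (n div 3), n mod 3)) {..<3 * m}" using h(1) by (simp add: inj_on_def)
    fix x y assume "x \<in> {..<3 * m}" "y \<in> {..<3 * m}"
    then have "x div 3 \<in> {..<m}" "y div 3 \<in> {..<m}" by auto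
    then show "map_option fst (Some (h (x div 3), x mod 3)) = map_option fst (Some (h (y div 3), y mod 3)) \<longleftrightarrow>
        x div 3 = y div 3"
      using h(3) by (simp add: inj_on_eq_iff)
  qed
qed

lemma triple_cone_edges:
  assumes "triple (multipartite {..<Suc (3 * m)} (\<lambda>x. x)) k" "finite b" "card b = m"
  shows "triple (cone_edges b) k"
proof -
  obtain h where h: "inj_on (\<lambda>n. (h (n div 3), n mod 3)) {..<3 * m}"
    "inflate b = (\<lambda>n. Some (h (n div 3), n mod 3)) ` {..<3 * m}"
    using inflate_bij[OF assms(2,3)] .
  \<comment> \<open>The last number \<open>3 * m\<close> becomes the point at infinity.\<close>
  define f where "f n = (if n < 3 * m then Some (h (n div 3), n mod 3) else None)" for n
  have "f ` {..<3 * m} = inflate b" unfolding h(2) f_def by (intro image_cong) auto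
  moreover have "f (3 * m) = None" by (simp add: f_def)
  ultimately have im: "insert None (inflate b) = f ` {..<Suc (3 * m)}" by (simp add: lessThan_Suc)
  have inj: "inj_on f {..<Suc (3 * m)}"
  proof -
    have "inj_on f {..<3 * m}" using h(1) by (simp add: inj_on_def f_def)
    moreover have "f (3 * m) \<notin> f ` {..<3 * m}" by (auto simp: f_def)
    ultimately show ?thesis by (simp add: lessThan_Suc)
  qed
  show ?thesis unfolding cone_edges_def im
    using inj by (intro triple_image[OF assms(1)]) (simp_all add: inj_on_eq_iff)
qed

lemma card_cone_points:
  assumes "finite b"
  shows "finite (insert None (inflate b))" "card (insert None (inflate b)) = Suc (3 * card b)"
  using assms by (auto simp: inflate_def card_image card_cartesian_product image_iff)

text \<open>A one-point cone is a single block. Such blocks serve the points off all lines that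
  carry a cone.\<close>

lemma triple_cone_point: "triple (cone_edges {p}) 1"
proof -
  let ?V = "insert None (inflate {p})"
  have "decomp (multipartite ?V (\<lambda>x. x)) {?V}"
    by (rule decompI) (simp_all add: multipartite_def)
  moreover have "card ?V = 4" using card_cone_points[of "{p}"] by simp
  ultimately have "decomp4 (cone_edges {p}) {?V}" by (simp add: decomp4_def cone_edges_def)
  from triple_full[OF this] show ?thesis by simp
qed

text \<open>A pair over two different points lies over one line. A pair within a fibre, or with
  infinity, belongs to the cone over the line of \<open>T\<close> through the point below or,
  failing that, to the one-point cone. Disjointness of the lines in \<open>T\<close> prevents double
  covering.\<close>

lemma triple_inflation:
  assumes fin: "finite P" and D: "decomp (multipartite P (\<lambda>x. x)) S"
    and sub: "\<And>b. b \<in> S \<Longrightarrow> b \<subseteq> P" and TS: "T \<subseteq> S"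
    and disj: "\<And>b c. b \<in> T \<Longrightarrow> c \<in> T \<Longrightarrow> b \<noteq> c \<Longrightarrow> b \<inter> c = {}"
    and T: "\<And>b. b \<in> T \<Longrightarrow> triple (cone_edges b) (k b)"
    and S: "\<And>b. b \<in> S - T \<Longrightarrow> triple (line_edges b) (k b)"
  shows "triple (cone_edges P) ((\<Sum>b\<in>S. k b) + card (P - \<Union>T))"
proof -
  define E where "E b = (if b \<in> T then cone_edges b else line_edges b)" for b
  let ?L = "\<Union>b\<in>S. E b" and ?F = "\<Union>p\<in>P - \<Union>T. cone_edges {p}"
  have same: "b = c" if "b \<in> S" "c \<in> S" "p \<noteq> q" "p \<in> b" "q \<in> b" "p \<in> c" "q \<in> c" for b c p q
    using decomp_unique[OF D] that by metis
  have sameT: "b = c" if "b \<in> T" "c \<in> T" "p \<in> b" "p \<in> c" for b c p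
    using disj that by blast
  have E_Some: "p \<in> b \<and> q \<in> b \<and> (p = q \<longrightarrow> b \<in> T)" if "(Some (p, i), Some (q, j)) \<in> E b" for p q i j b
    using that by (auto simp: E_def split: if_splits)
  have E_None: "b \<in> T \<and> q \<in> b" if "(None, Some (q, j)) \<in> E b \<or> (Some (q, j), None) \<in> E b" for q j b
    using that by (auto simp: E_def split: if_splits)
  have E_NN: "(None, None) \<notin> E b" for b by (simp add: E_def)
  \<comment> \<open>A common edge would give the lines two common points, or one common point with
    both lines in \<open>T\<close>.\<close>
  have EE: "E b \<inter> E c = {}" if bc: "b \<in> S" "c \<in> S" "b \<noteq> c" for b c
  proof -
    have False if xy: "(x, y) \<in> E b" "(x, y) \<in> E c" for x y
    proof (cases x; cases y)
      fix u v assume u: "x = Some u" "y = Some v"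
      obtain p i q j where "u = (p, i)" "v = (q, j)" by (meson surj_pair)
      then have "p \<in> b" "q \<in> b" "p \<in> c" "q \<in> c" "p = q \<Longrightarrow> b \<in> T \<and> c \<in> T"
        using E_Some xy u by blast+
      then show False using same[OF bc(1,2), of p q] sameT[of b c p] bc(3) by metis
    next
      fix v assume u: "x = None" "y = Some v"
      obtain q j where "v = (q, j)" by (meson surj_pair)
      then have "b \<in> T" "c \<in> T" "q \<in> b" "q \<in> c" using E_None xy u by blast+
      then show False using sameT bc(3) by blast
    next
      fix v assume u: "x = Some v" "y = None"
      obtain q j where "v = (q, j)" by (meson surj_pair)
      then have "b \<in> T" "c \<in> T" "q \<in> b" "q \<in> c" using E_None xy u by blast+
      then show False using sameT bc(3) by blast
    next
      assume "x = None" "y = None"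
      then show False using xy E_NN by simp
    qed
    then show ?thesis by auto
  qed
  have "triple ?L (\<Sum>b\<in>S. k b)"
    by (rule triple_UN[OF decomp_finite[OF D] _ EE]) (simp_all add: E_def T S)
  moreover have "triple ?F (\<Sum>p\<in>P - \<Union>T. 1)"
  proof (rule triple_UN)
    show "cone_edges {p} \<inter> cone_edges {q} = {}" if "p \<noteq> q" for p q
    proof -
      have "(x, y) \<notin> cone_edges {q}" if "(x, y) \<in> cone_edges {p}" for x y
        using that \<open>p \<noteq> q\<close> by (cases x; cases y) auto
      then show ?thesis by auto
    qed
  qed (use fin in \<open>simp_all only: finite_Diff triple_cone_point\<close>)
  moreover have "?L \<inter> ?F = {}"
  proof -
    have "(x, y) \<notin> cone_edges {p}" if "(x, y) \<in> E b" "p \<in> P - \<Union>T" for b x y p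
      using that by (cases x; cases y) (auto simp: E_def split: if_splits)
    then show ?thesis by auto
  qed
  ultimately have "triple (?L \<union> ?F) ((\<Sum>b\<in>S. k b) + (\<Sum>p\<in>P - \<Union>T. 1))" by (rule triple_Un)
  moreover have "?L \<union> ?F = cone_edges P"
  proof -
    have LP: "(x, y) \<in> cone_edges P" if "b \<in> S" "(x, y) \<in> E b" for b x y
      using that sub[OF that(1)] by (cases x; cases y) (auto simp: E_def split: if_splits)
    have FP: "(x, y) \<in> cone_edges P" if "p \<in> P" "(x, y) \<in> cone_edges {p}" for p x y
      using that by (cases x; cases y) auto
    have point: "(x, y) \<in> ?L \<union> ?F" if "p \<in> P" "(x, y) \<in> cone_edges {p}" for p x y
    proof (cases "p \<in> \<Union>T")
      case True
      then obtain b where b: "b \<in> T" "p \<in> b" by blast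
      then have "(x, y) \<in> cone_edges b" using that(2) by (cases x; cases y) auto
      then have "(x, y) \<in> E b" using b by (simp add: E_def)
      then show ?thesis using b TS by blast
    qed (use that in blast)
    \<comment> \<open>One-point cones contain the pairs within a fibre and the pairs with infinity;
      every other edge lies over two different points.\<close>
    have "(x, y) \<in> ?L \<union> ?F" if xy: "(x, y) \<in> cone_edges P" for x y
    proof (cases "\<exists>p\<in>P. (x, y) \<in> cone_edges {p}")
      case True
      then show ?thesis using point by blast
    next
      case False
      then obtain p i q j where pq: "x = Some (p, i)" "y = Some (q, j)" "p \<noteq> q"
        using xy by (cases x; cases y) auto
      then have "(p, q) \<in> multipartite P (\<lambda>x. x)" using xy by (simp add: multipartite_def)
      from decomp_cover[OF D this] obtain b where b: "b \<in> S" "p \<in> b" "q \<in> b" .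
      then have "(x, y) \<in> E b" using pq xy by (simp add: E_def)
      then show ?thesis using b(1) by blast
    qed
    moreover have "(x, y) \<in> cone_edges P" if "(x, y) \<in> ?L \<union> ?F" for x y
      using that LP FP by blast
    ultimately show ?thesis by (intro subset_antisym subrelI)
  qed
  ultimately show ?thesis by simp
qed

text \<open>The cone over 25 points has \<open>3 * 25 + 1 = 76\<close> points.\<close>

lemma J3_inflation:
  assumes "finite P" "card P = 25" "decomp (multipartite P (\<lambda>x. x)) S"
    and "\<And>b. b \<in> S \<Longrightarrow> b \<subseteq> P" and "T \<subseteq> S"
    and "\<And>b c. b \<in> T \<Longrightarrow> c \<in> T \<Longrightarrow> b \<noteq> c \<Longrightarrow> b \<inter> c = {}"
    and "\<And>b. b \<in> T \<Longrightarrow> triple (cone_edges b) (k b)"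
    and "\<And>b. b \<in> S - T \<Longrightarrow> triple (line_edges b) (k b)"
  shows "int ((\<Sum>b\<in>S. k b) + card (P - \<Union>T)) \<in> J3 76"
proof -
  have "triple (cone_edges P) ((\<Sum>b\<in>S. k b) + card (P - \<Union>T))"
    by (rule triple_inflation) (fact assms)+
  from J3_of_triple[OF card_cone_points(1)[OF assms(1)] this[unfolded cone_edges_def]] show ?thesis
    unfolding card_cone_points(2)[OF assms(1)] assms(2) by simp
qed

section \<open>Small triples\<close>

text \<open>
  The lists come from a computer search over images of the projective plane of order 3, of the
  affine plane of order 4, and of these planes with a point removed. \<open>C\<close> lists the common blocks.
\<close>

lemma triple_K13_0: "triple (multipartite {..<13::nat} (\<lambda>x. x)) 0"
  by (rule triple_of_lists[where C = "[]"
      and X = "[[0,1,2,12],[0,3,7,9],[0,4,6,10],[0,5,8,11],[1,3,6,11],[1,4,8,9],[1,5,7,10],[2,3,8,10],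
       [2,4,7,11],[2,5,6,9],[3,4,5,12],[6,7,8,12],[9,10,11,12]]"
      and Y = "[[0,1,7,12],[0,2,3,9],[0,4,6,11],[0,5,8,10],[1,2,6,10],[1,3,4,8],[1,5,9,11],[2,4,5,7],
       [2,8,11,12],[3,5,6,12],[3,7,10,11],[4,9,10,12],[6,7,8,9]]"
      and Z = "[[0,1,5,9],[0,2,6,7],[0,3,11,12],[0,4,8,10],[1,2,8,12],[1,3,7,10],[1,4,6,11],[2,3,4,9],
       [2,5,10,11],[3,5,6,8],[4,5,7,12],[6,9,10,12],[7,8,9,11]]"])
    code_simp+

lemma triple_K13_1: "triple (multipartite {..<13::nat} (\<lambda>x. x)) 1"
  by (rule triple_of_lists[where C = "[[6,7,8,12]]"
      and X = "[[0,1,2,12],[0,3,7,9],[0,4,6,10],[0,5,8,11],[1,3,6,11],[1,4,8,9],[1,5,7,10],[2,3,8,10],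
       [2,4,7,11],[2,5,6,9],[3,4,5,12],[9,10,11,12]]"
      and Y = "[[0,1,6,10],[0,2,3,7],[0,4,5,12],[0,8,9,11],[1,2,5,8],[1,3,9,12],[1,4,7,11],[2,4,6,9],
       [2,10,11,12],[3,4,8,10],[3,5,6,11],[5,7,9,10]]"
      and Z = "[[0,1,9,12],[0,2,6,10],[0,3,5,7],[0,4,8,11],[1,2,3,8],[1,4,5,6],[1,7,10,11],[2,4,7,9],
       [2,5,11,12],[3,4,10,12],[3,6,9,11],[5,8,9,10]]"])
    code_simp+

lemma triple_K13_2: "triple (multipartite {..<13::nat} (\<lambda>x. x)) 2"
  by (rule triple_of_lists[where C = "[[0,4,6,10],[2,5,6,9]]"
      and X = "[[0,1,2,12],[0,3,7,9],[0,5,8,11],[1,3,6,11],[1,4,8,9],[1,5,7,10],[2,3,8,10],[2,4,7,11],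
       [3,4,5,12],[6,7,8,12],[9,10,11,12]]"
      and Y = "[[0,1,5,8],[0,2,3,12],[0,7,9,11],[1,2,4,7],[1,3,9,10],[1,6,11,12],[2,8,10,11],[3,4,5,11],
       [3,6,7,8],[4,8,9,12],[5,7,10,12]]"
      and Z = "[[0,1,9,12],[0,2,7,8],[0,3,5,11],[1,2,4,11],[1,3,6,7],[1,5,8,10],[2,3,10,12],[3,4,8,9],
       [4,5,7,12],[6,8,11,12],[7,9,10,11]]"])
    code_simp+

lemma triple_K13_3: "triple (multipartite {..<13::nat} (\<lambda>x. x)) 3"
  by (rule triple_of_lists[where C = "[[0,1,2,12],[0,5,8,11],[3,4,5,12]]"
      and X = "[[0,3,7,9],[0,4,6,10],[1,3,6,11],[1,4,8,9],[1,5,7,10],[2,3,8,10],[2,4,7,11],[2,5,6,9],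
       [6,7,8,12],[9,10,11,12]]"
      and Y = "[[0,3,7,10],[0,4,6,9],[1,3,9,11],[1,4,7,8],[1,5,6,10],[2,3,6,8],[2,4,10,11],[2,5,7,9],
       [6,7,11,12],[8,9,10,12]]"
      and Z = "[[0,3,6,10],[0,4,7,9],[1,3,8,9],[1,4,10,11],[1,5,6,7],[2,3,7,11],[2,4,6,8],[2,5,9,10],
       [6,9,11,12],[7,8,10,12]]"])
    code_simp+

text \<open>The common blocks are the four blocks through the point 12; the others decompose the
  multipartite graph of type \<open>3\<^sup>4\<close>.\<close>

lemma triple_K13_4: "triple (multipartite {..<13::nat} (\<lambda>x. x)) 4"
  by (rule triple_of_lists[where C = "[[0,1,2,12],[3,4,5,12],[6,7,8,12],[9,10,11,12]]"
      and X = "[[0,3,7,9],[0,4,6,10],[0,5,8,11],[1,3,6,11],[1,4,8,9],[1,5,7,10],[2,3,8,10],[2,4,7,11],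
       [2,5,6,9]]"
      and Y = "[[0,3,6,9],[0,4,8,10],[0,5,7,11],[1,3,8,11],[1,4,7,9],[1,5,6,10],[2,3,7,10],[2,4,6,11],
       [2,5,8,9]]"
      and Z = "[[0,3,6,10],[0,4,8,11],[0,5,7,9],[1,3,8,9],[1,4,7,10],[1,5,6,11],[2,3,7,11],[2,4,6,9],
       [2,5,8,10]]"])
    code_simp+

lemma triple_K13_5: "triple (multipartite {..<13::nat} (\<lambda>x. x)) 5"
  by (rule triple_of_lists[where C = "[[0,4,6,10],[0,5,8,11],[1,5,7,10],[2,5,6,9],[3,4,5,12]]"
      and X = "[[0,1,2,12],[0,3,7,9],[1,3,6,11],[1,4,8,9],[2,3,8,10],[2,4,7,11],[6,7,8,12],[9,10,11,12]]"
      and Y = "[[0,1,9,12],[0,2,3,7],[1,2,4,11],[1,3,6,8],[2,8,10,12],[3,9,10,11],[4,7,8,9],[6,7,11,12]]"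
      and Z = "[[0,1,3,9],[0,2,7,12],[1,2,4,8],[1,6,11,12],[2,3,10,11],[3,6,7,8],[4,7,9,11],[8,9,10,12]]"])
    code_simp+

lemma triple_K13_13: "triple (multipartite {..<13::nat} (\<lambda>x. x)) 13"
  by (rule triple_of_lists[where C = "[[0,1,2,12],[0,3,7,9],[0,4,6,10],[0,5,8,11],[1,3,6,11],[1,4,8,9],[1,5,7,10],[2,3,8,10],
       [2,4,7,11],[2,5,6,9],[3,4,5,12],[6,7,8,12],[9,10,11,12]]"
      and X = "[]"
      and Y = "[]"
      and Z = "[]"])
    code_simp+

lemma triple_3_4_0: "triple (multipartite {..<12::nat} (\<lambda>x. x div 3)) 0"
  by (rule triple_of_lists[where C = "[]"
      and X = "[[0,3,7,9],[0,4,6,10],[0,5,8,11],[1,3,6,11],[1,4,8,9],[1,5,7,10],[2,3,8,10],[2,4,7,11],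
       [2,5,6,9]]"
      and Y = "[[0,3,7,11],[0,4,6,9],[0,5,8,10],[1,3,6,10],[1,4,8,11],[1,5,7,9],[2,3,8,9],[2,4,7,10],
       [2,5,6,11]]"
      and Z = "[[0,3,6,11],[0,4,7,10],[0,5,8,9],[1,3,8,10],[1,4,6,9],[1,5,7,11],[2,3,7,9],[2,4,8,11],
       [2,5,6,10]]"])
    code_simp+

text \<open>The plane in \<open>triple_K13_13\<close> without the point 12 and the four lines
  through it.\<close>

lemma triple_3_4_9: "triple (multipartite {..<12::nat} (\<lambda>x. x div 3)) 9"
  by (rule triple_of_lists[where C = "[[0,3,7,9],[0,4,6,10],[0,5,8,11],[1,3,6,11],[1,4,8,9],[1,5,7,10],[2,3,8,10],[2,4,7,11],
       [2,5,6,9]]"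
      and X = "[]"
      and Y = "[]"
      and Z = "[]"])
    code_simp+

lemma triple_K16_0: "triple (multipartite {..<16::nat} (\<lambda>x. x)) 0"
  by (rule triple_of_lists[where C = "[]"
      and X = "[[0,1,2,15],[0,3,6,9],[0,4,8,14],[0,5,10,13],[0,7,11,12],[1,3,11,14],[1,4,7,10],
       [1,5,6,12],[1,8,9,13],[2,3,7,13],[2,4,9,12],[2,5,8,11],[2,6,10,14],[3,4,5,15],
       [3,8,10,12],[4,6,11,13],[5,7,9,14],[6,7,8,15],[9,10,11,15],[12,13,14,15]]"
      and Y = "[[0,1,3,5],[0,2,10,13],[0,4,6,14],[0,7,9,11],[0,8,12,15],[1,2,7,8],[1,4,10,11],[1,6,9,15],
       [1,12,13,14],[2,3,4,15],[2,5,9,14],[2,6,11,12],[3,6,7,13],[3,8,11,14],[3,9,10,12],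
       [4,5,7,12],[4,8,9,13],[5,6,8,10],[5,11,13,15],[7,10,14,15]]"
      and Z = "[[0,1,3,9],[0,2,4,7],[0,5,8,11],[0,6,12,14],[0,10,13,15],[1,2,8,15],[1,4,5,14],
       [1,6,10,11],[1,7,12,13],[2,3,10,14],[2,5,6,13],[2,9,11,12],[3,4,11,13],[3,5,12,15],
       [3,6,7,8],[4,6,9,15],[4,8,10,12],[5,7,9,10],[7,11,14,15],[8,9,13,14]]"])
    code_simp+

lemma triple_3_5_0: "triple (multipartite {..<15::nat} (\<lambda>x. x div 3)) 0"
  by (rule triple_of_lists[where C = "[]"
      and X = "[[0,3,6,9],[0,4,8,14],[0,5,10,13],[0,7,11,12],[1,3,11,14],[1,4,7,10],[1,5,6,12],
       [1,8,9,13],[2,3,7,13],[2,4,9,12],[2,5,8,11],[2,6,10,14],[3,8,10,12],[4,6,11,13],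
       [5,7,9,14]]"
      and Y = "[[0,3,7,11],[0,4,6,13],[0,5,10,12],[0,8,9,14],[1,3,9,13],[1,4,8,10],[1,5,7,14],
       [1,6,11,12],[2,3,8,12],[2,4,11,14],[2,5,6,9],[2,7,10,13],[3,6,10,14],[4,7,9,12],
       [5,8,11,13]]"
      and Z = "[[0,3,6,12],[0,4,10,13],[0,5,7,9],[0,8,11,14],[1,3,8,10],[1,4,7,14],[1,5,11,12],
       [1,6,9,13],[2,3,9,14],[2,4,6,11],[2,5,8,13],[2,7,10,12],[3,7,11,13],[4,8,9,12],
       [5,6,10,14]]"])
    code_simp+

lemma triple_3_5_1: "triple (multipartite {..<15::nat} (\<lambda>x. x div 3)) 1"
  by (rule triple_of_lists[where C = "[[0,4,8,14]]"
      and X = "[[0,3,6,9],[0,5,10,13],[0,7,11,12],[1,3,11,14],[1,4,7,10],[1,5,6,12],[1,8,9,13],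
       [2,3,7,13],[2,4,9,12],[2,5,8,11],[2,6,10,14],[3,8,10,12],[4,6,11,13],[5,7,9,14]]"
      and Y = "[[0,3,7,9],[0,5,10,12],[0,6,11,13],[1,3,6,12],[1,4,9,13],[1,5,8,11],[1,7,10,14],
       [2,3,11,14],[2,4,6,10],[2,5,7,13],[2,8,9,12],[3,8,10,13],[4,7,11,12],[5,6,9,14]]"
      and Z = "[[0,3,6,11],[0,5,9,12],[0,7,10,13],[1,3,10,14],[1,4,7,9],[1,5,6,13],[1,8,11,12],
       [2,3,7,12],[2,4,11,13],[2,5,8,10],[2,6,9,14],[3,8,9,13],[4,6,10,12],[5,7,11,14]]"])
    code_simp+

text \<open>The first plane in \<open>triple_K16_0\<close> without the point 15 and the five lines
  through it.\<close>

lemma triple_3_5_15: "triple (multipartite {..<15::nat} (\<lambda>x. x div 3)) 15"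
  by (rule triple_of_lists[where C = "[[0,3,6,9],[0,4,8,14],[0,5,10,13],[0,7,11,12],[1,3,11,14],[1,4,7,10],[1,5,6,12],
       [1,8,9,13],[2,3,7,13],[2,4,9,12],[2,5,8,11],[2,6,10,14],[3,8,10,12],[4,6,11,13],
       [5,7,9,14]]"
      and X = "[]"
      and Y = "[]"
      and Z = "[]"])
    code_simp+

section \<open>The two linear spaces on 25 points\<close>

text \<open>
  The point \<open>(x, y)\<close> of \<open>\<int>\<^sub>5 \<times> \<int>\<^sub>5\<close> is coded as \<open>5x + y\<close>. The blocks of \<open>S25\<close> are the translates of
  \<open>{(0,0), (0,1), (1,0), (2,2)}\<close> and \<open>{(0,0), (0,2), (2,0), (4,4)}\<close>.
\<close>

definition S25 :: "nat list list" where
  "S25 =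
     [[0,1,5,12],[0,2,10,24],[0,3,13,22],[0,4,9,11],[0,6,8,16],[0,7,20,21],[0,14,15,17],
      [0,18,19,23],[1,2,6,13],[1,3,11,20],[1,4,14,23],[1,7,9,17],[1,8,21,22],[1,10,16,18],
      [1,15,19,24],[2,3,7,14],[2,4,12,21],[2,5,8,18],[2,9,22,23],[2,11,17,19],[2,15,16,20],
      [3,4,8,10],[3,5,23,24],[3,6,9,19],[3,12,15,18],[3,16,17,21],[4,5,7,15],[4,6,20,24],
      [4,13,16,19],[4,17,18,22],[5,6,10,17],[5,9,14,16],[5,11,13,21],[5,19,20,22],[6,7,11,18],
      [6,12,14,22],[6,15,21,23],[7,8,12,19],[7,10,13,23],[7,16,22,24],[8,9,13,15],[8,11,14,24],
      [8,17,20,23],[9,10,12,20],[9,18,21,24],[10,11,15,22],[10,14,19,21],[11,12,16,23],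
      [12,13,17,24],[13,14,18,20]]"

text \<open>The lines of the affine plane over the field with five elements, in the same coding of
  points.\<close>

definition AG25 :: "nat list list" where
  "AG25 =
     [[0,1,2,3,4],[0,5,10,15,20],[0,6,12,18,24],[0,7,14,16,23],[0,8,11,19,22],[0,9,13,17,21],
      [1,5,14,18,22],[1,6,11,16,21],[1,7,13,19,20],[1,8,10,17,24],[1,9,12,15,23],[2,5,13,16,24],
      [2,6,10,19,23],[2,7,12,17,22],[2,8,14,15,21],[2,9,11,18,20],[3,5,12,19,21],[3,6,14,17,20],
      [3,7,11,15,24],[3,8,13,18,23],[3,9,10,16,22],[4,5,11,17,23],[4,6,13,15,22],[4,7,10,18,21],
      [4,8,12,16,20],[4,9,14,19,24],[5,6,7,8,9],[10,11,12,13,14],[15,16,17,18,19],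
      [20,21,22,23,24]]"

text \<open>Disjoint blocks of \<open>S25\<close> that will carry cones; the other 17 points get
  one-point cones.\<close>

definition S25_class :: "nat list list" where
  "S25_class = [[0,1,5,12],[2,3,7,14]]"

text \<open>The parallel class of lines with constant \<open>x\<close>; it leaves no point for a
  one-point cone.\<close>

definition AG25_class :: "nat list list" where
  "AG25_class = [[0,1,2,3,4],[5,6,7,8,9],[10,11,12,13,14],[15,16,17,18,19],[20,21,22,23,24]]"

text \<open>A form of \<open>J3_inflation\<close> for evaluation: \<open>M\<close> lists the lines
  that carry cones, distinctness of \<open>concat M\<close> makes them disjoint, and the difference
  counts the points off them.\<close>

lemma J3_of_lists:
  assumes ok: "blocks_ok 25 (\<lambda>x. x) L" and sorted: "sized_sorted m L"
    and M: "list_all (List.member L) M" "distinct (concat M)"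
    and kM: "\<And>b. b \<in> set M \<Longrightarrow> triple (multipartite {..<Suc (3 * m)} (\<lambda>x. x)) (k b)"
    and kL: "\<And>b. b \<in> set L - set M \<Longrightarrow> triple (multipartite {..<3 * m} (\<lambda>x. x div 3)) (k b)"
  shows "int ((\<Sum>b\<in>set L. k b) + (25 - length (concat M))) \<in> J3 76"
proof -
  have inj: "inj_on set (set L)" and card: "\<And>b. b \<in> set L \<Longrightarrow> card (set b) = m"
    using sized_sorted_sets[OF sorted] by blast+
  have MsubL: "set M \<subseteq> set L" using M(1) by (auto simp: list_all_iff)
  have sub: "set b \<subseteq> {..<25}" if "b \<in> set L" for b
    using ok that unfolding blocks_ok_def by (auto simp: list_all_iff)
  \<comment> \<open>The numbers are moved from lists to their sets, on which
    \<open>J3_inflation\<close> works.\<close>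
  define k' where "k' B = k (the_inv_into (set L) set B)" for B
  have k': "k' (set b) = k b" if "b \<in> set L" for b
    unfolding k'_def using that by (simp add: the_inv_into_f_f[OF inj])
  have disj: "B \<inter> C = {}" if BC: "B \<in> set ` set M" "C \<in> set ` set M" "B \<noteq> C" for B C
  proof -
    obtain b c where bc: "B = set b" "b \<in> set M" "C = set c" "c \<in> set M" using BC by (elim imageE)
    have "b = c" if "y \<in> set b" "y \<in> set c" for y
      by (rule distinct_concat_map_eq[of "\<lambda>x. x" M b c y]) (simp_all add: M(2) bc that)
    then show ?thesis using bc BC(3) by blast
  qed
  have "\<Union> (set ` set M) = set (concat M)" by simp
  moreover have "set b \<subseteq> {..<25}" if "b \<in> set M" for b using that sub MsubL by blast
  then have "set (concat M) \<subseteq> {..<25}" by auto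
  ultimately have "card ({..<25} - \<Union> (set ` set M)) = 25 - length (concat M)"
    using card_Diff_subset[of "set (concat M)" "{..<25::nat}"] distinct_card[OF M(2)] by simp
  moreover have "(\<Sum>B\<in>set ` set L. k' B) = (\<Sum>b\<in>set L. k b)"
    using inj k' by (simp add: sum.reindex)
  moreover have "int ((\<Sum>B\<in>set ` set L. k' B) + card ({..<25} - \<Union> (set ` set M))) \<in> J3 76"
  proof (rule J3_inflation)
    show "decomp (multipartite {..<25} (\<lambda>x. x)) (set ` set L)" by (rule decomp_of_blocks_ok[OF ok])
    show "set ` set M \<subseteq> set ` set L" using MsubL by (rule image_mono)
    show "B \<subseteq> {..<25}" if "B \<in> set ` set L" for B
      using that sub by blast
    show "triple (cone_edges B) (k' B)" if B: "B \<in> set ` set M" for B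
    proof -
      obtain b where b: "B = set b" "b \<in> set M" using B by (elim imageE)
      then have "b \<in> set L" using MsubL by blast
      then show ?thesis
        using triple_cone_edges[OF kM[OF b(2)], of "set b"] card k' b(1) by simp
    qed
    show "triple (line_edges B) (k' B)" if B: "B \<in> set ` set L - set ` set M" for B
    proof -
      obtain b where b: "B = set b" "b \<in> set L" using B by blast
      then have "b \<in> set L - set M" using B by blast
      from triple_line_edges[OF kL[OF this], of "set b"] show ?thesis
        using card k' b by simp
    qed
  qed (simp_all add: disj)
  ultimately show ?thesis by simp
qed

text \<open>Which \<open>a\<close> of the lines outside \<open>M\<close> receive the number
  \<open>c\<close> is immaterial, so any subset of that size is chosen.\<close>

lemma J3_of_lists_two_values:
  assumes ok: "blocks_ok 25 (\<lambda>x. x) L" "sized_sorted m L" "distinct L"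
    and M: "list_all (List.member L) M" "distinct (concat M)" "distinct M"
    and kM: "\<And>b. b \<in> set M \<Longrightarrow> triple (multipartite {..<Suc (3 * m)} (\<lambda>x. x)) (k b)"
    and c: "triple (multipartite {..<3 * m} (\<lambda>x. x div 3)) c"
    and d: "triple (multipartite {..<3 * m} (\<lambda>x. x div 3)) d"
    and a: "a + a' + length M = length L"
  shows "int ((\<Sum>b\<in>set M. k b) + c * a + d * a' + (25 - length (concat M))) \<in> J3 76"
proof -
  have MsubL: "set M \<subseteq> set L" using M(1) by (auto simp: list_all_iff)
  have "card (set L - set M) = a + a'"
    using MsubL a distinct_card[OF ok(3)] distinct_card[OF M(3)] by (simp add: card_Diff_subset)
  then obtain U where U: "U \<subseteq> set L - set M" "card U = a"
    using obtain_subset_with_card_n[of a "set L - set M"] by auto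
  define k' where "k' b = (if b \<in> set M then k b else if b \<in> U then c else d)" for b
  have "int ((\<Sum>b\<in>set L. k' b) + (25 - length (concat M))) \<in> J3 76"
    by (rule J3_of_lists[OF ok(1,2) M(1,2)]) (use kM c d in \<open>auto simp: k'_def\<close>)
  moreover have "(\<Sum>b\<in>set L. k' b) = (\<Sum>b\<in>set M. k b) + c * a + d * a'"
  proof -
    let ?R = "set L - set M - U"
    have "card ?R = a'"
      using U \<open>card (set L - set M) = a + a'\<close> by (subst card_Diff_subset) (auto intro: finite_subset)
    moreover have "(\<Sum>b\<in>set L. k' b) = (\<Sum>b\<in>set M. k' b) + ((\<Sum>b\<in>U. k' b) + (\<Sum>b\<in>?R. k' b))"
      using sum.subset_diff[OF MsubL, of k'] sum.subset_diff[OF U(1), of k'] by simp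
    moreover have "(\<Sum>b\<in>set M. k' b) = (\<Sum>b\<in>set M. k b)" by (simp add: k'_def)
    moreover have "(\<Sum>b\<in>U. k' b) = (\<Sum>b\<in>U. c)" using U(1) by (intro sum.cong) (auto simp: k'_def)
    moreover have "(\<Sum>b\<in>?R. k' b) = (\<Sum>b\<in>?R. d)" by (intro sum.cong) (auto simp: k'_def)
    ultimately show ?thesis using U(2) by (simp add: mult.commute)
  qed
  ultimately show ?thesis by simp
qed

section \<open>All intersection numbers for 76 points\<close>

lemma S25_checks:
  "blocks_ok 25 (\<lambda>x. x) S25" "sized_sorted 4 S25" "distinct S25" "length S25 = 50"
  "list_all (List.member S25) S25_class" "distinct (concat S25_class)"
  "distinct S25_class" "length (concat S25_class) = 8" "length S25_class = 2"
  by code_simp+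

lemma AG25_checks:
  "blocks_ok 25 (\<lambda>x. x) AG25" "sized_sorted 5 AG25" "distinct AG25" "length AG25 = 30"
  "list_all (List.member AG25) AG25_class" "distinct (concat AG25_class)" "distinct AG25_class"
  "length (concat AG25_class) = 25" "length AG25_class = 5"
  by code_simp+

lemma triple_K13:
  assumes "k \<le> 5 \<or> k = 13"
  shows "triple (multipartite {..<13::nat} (\<lambda>x. x)) k"
proof -
  consider "k = 0" | "k = 1" | "k = 2" | "k = 3" | "k = 4" | "k = 5" | "k = 13"
    using assms by linarith
  then show ?thesis
    by cases (simp_all only: triple_K13_0 triple_K13_1 triple_K13_2 triple_K13_3 triple_K13_4
        triple_K13_5 triple_K13_13)
qed

text \<open>The summands come from the two cones, from \<open>a\<close> of the 48 other lines, and
  from the 17 one-point cones.\<close>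

lemma J3_76_S25:
  assumes x: "x \<le> 5 \<or> x = 13" and y: "y \<le> 5 \<or> y = 13" and a: "a \<le> 48"
  shows "int (x + y + 9 * a + 17) \<in> J3 76"
proof -
  obtain s t where st: "S25_class = [s, t]" unfolding S25_class_def by blast
  have neq: "s \<noteq> t" using S25_checks(7) unfolding st by simp
  define k where "k b = (if b = s then x else y)" for b
  have "int ((\<Sum>b\<in>set S25_class. k b) + 9 * a + 0 * (48 - a) + (25 - length (concat S25_class))) \<in> J3 76"
  proof (rule J3_of_lists_two_values[OF S25_checks(1-3,5-7)])
    show "triple (multipartite {..<Suc (3 * 4)} (\<lambda>x. x)) (k b)" for b
      using triple_K13[OF x] triple_K13[OF y] by (simp add: k_def)
    show "a + (48 - a) + length S25_class = length S25" using a S25_checks(4,9) by simp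
  qed (use triple_3_4_9 triple_3_4_0 in simp_all)
  moreover have "(\<Sum>b\<in>set S25_class. k b) = x + y" unfolding st using neq by (simp add: k_def)
  ultimately show ?thesis using S25_checks(8) by simp
qed

text \<open>No line carries a cone: 29 lines give 15 each, one gives \<open>d\<close>, and the 25
  one-point cones give 1 each.\<close>

lemma J3_76_AG25_lines:
  assumes "d \<le> 1"
  shows "int (460 + d) \<in> J3 76"
proof -
  have "int ((\<Sum>b\<in>set ([] :: nat list list). 0) + 15 * 29 + d * 1 + (25 - length (concat ([] :: nat list list)))) \<in> J3 76"
  proof (rule J3_of_lists_two_values[OF AG25_checks(1-3)])
    show "triple (multipartite {..<3 * 5 :: nat} (\<lambda>x. x div 3)) d"
      using assms triple_3_5_0 triple_3_5_1 by (cases "d = 0") (simp_all add: le_Suc_eq)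
  qed (use triple_3_5_15 AG25_checks(4) in simp_all)
  then show ?thesis by simp
qed

text \<open>The five cones contribute 0, and each of the 25 other lines contributes 0 or 1.\<close>

lemma J3_76_AG25_cones:
  assumes "a \<le> 25"
  shows "int a \<in> J3 76"
proof -
  have "int ((\<Sum>b\<in>set AG25_class. 0) + 1 * a + 0 * (25 - a) + (25 - length (concat AG25_class))) \<in> J3 76"
    by (rule J3_of_lists_two_values[OF AG25_checks(1-3,5-7)])
      (use triple_K16_0 triple_3_5_0 triple_3_5_1 AG25_checks(4,9) assms in simp_all)
  then show ?thesis using AG25_checks(8) by simp
qed

lemma J3_76_attained:
  assumes "k \<le> 467 \<or> k = 475"
  shows "int k \<in> J3 76"
proof -
  consider "k \<le> 25" | "25 < k" "k \<le> 459" | "k = 460" | "k = 461" | "462 \<le> k" "k \<le> 467" | "k = 475"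
    using assms by linarith
  then show ?thesis
  proof cases
    case 1
    then show ?thesis by (rule J3_76_AG25_cones)
  next
    case 2
    \<comment> \<open>Only 48 lines lie outside the class, hence the cap. Up to
      \<open>k = 459\<close> the remainder is at most 10 and splits into two summands of at most
      5.\<close>
    define a where "a = min 48 ((k - 17) div 9)"
    define r where "r = k - 17 - 9 * a"
    have r: "r \<le> 10" "k = r + 9 * a + 17" using 2 unfolding r_def a_def by auto
    have "int (min r 5 + (r - min r 5) + 9 * a + 17) \<in> J3 76"
      by (rule J3_76_S25) (use r(1) in \<open>auto simp: a_def\<close>)
    then show ?thesis unfolding r(2) by simp
  next
    case 3
    then show ?thesis using J3_76_AG25_lines[of 0] by simp
  next
    case 4
    then show ?thesis using J3_76_AG25_lines[of 1] by simp
  next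
    case 5
    \<comment> \<open>One cone and all multipartite pieces are common; the other cone supplies 0 to
      5.\<close>
    then have k: "13 + (k - 462) + 9 * 48 + 17 = k" by simp
    have "int (13 + (k - 462) + 9 * 48 + 17) \<in> J3 76"
      by (rule J3_76_S25) (use 5 in auto)
    then show ?thesis unfolding k .
  next
    case 6
    then show ?thesis using J3_76_S25[of 13 13 48] by simp
  qed
qed

theorem theorem5p5: "J3 76 = I3 76"
proof -
  \<comment> \<open>\<open>block_count 76\<close> is 475, so the excluded values are 468 to
    474.\<close>
  have I: "I3 76 = {k. 0 \<le> k \<and> (k \<le> 467 \<or> k = 475)}"
    unfolding I3_def block_count_def by auto
  show ?thesis
  proof (rule set_eqI, rule iffI)
    fix k assume "k \<in> J3 76"
    then show "k \<in> I3 76" unfolding I by (simp add: J3_76_bound)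
  next
    fix k assume k: "k \<in> I3 76"
    then have "int (nat k) \<in> J3 76" unfolding I by (intro J3_76_attained) auto
    moreover have "int (nat k) = k" using k unfolding I by simp
    ultimately show "k \<in> J3 76" by simp
  qed
qed

end
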